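(* For every $m\ge1$, the exponential growth constant $\alpha_m=\lim_{n\to\infty}(a_n^{(m)})^{1/n}$ exists. Moreover, $\alpha_m\le\alpha_{m+1}$ for every $m\ge1$, and \[ C_{m-1}^{1/(m+1)}\le\alpha_m<4 \] for every finite $m\ge1$, where $C_j=\frac{1}{j+1}\binom{2j}{j}$ is the $j$th Catalan number. Consequently $\lim_{m\to\infty}\alpha_m=4$, and more precisely $4-\alpha_m=O\!\left(\frac{\log m}{m}\right)$ as $m\to\infty$.
   Context: A permutation $\pi\in S_n$ avoids $132$ if there are no indices $i<j<k$ with $\pi_i<\pi_k<\pi_j$. For fixed $m\ge1$, $a_n^{(m)}$ is the number of $132$-avoiding $\pi\in S_n$ with $|\pi_{i+1}-\pi_i|\le m$ for all $1\le i<n$. *)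

theory Defs
  imports
    "HOL-Analysis.Analysis"
    "HOL-Combinatorics.Permutations"
    "HOL-Library.Landau_Symbols"
begin

definition avoids_132 :: "nat \<Rightarrow> (nat \<Rightarrow> nat) \<Rightarrow> bool" where
  "avoids_132 n \<pi> \<longleftrightarrow>
     \<not> (\<exists>i j k. 1 \<le> i \<and> i < j \<and> j < k \<and> k \<le> n \<and> \<pi> i < \<pi> k \<and> \<pi> k < \<pi> j)"

definition bounded_steps :: "nat \<Rightarrow> nat \<Rightarrow> (nat \<Rightarrow> nat) \<Rightarrow> bool" where
  "bounded_steps m n \<pi> \<longleftrightarrow>
     (\<forall>i. 1 \<le> i \<and> i < n \<longrightarrow> \<bar>int (\<pi> (i + 1)) - int (\<pi> i)\<bar> \<le> int m)"

definition num_perms :: "nat \<Rightarrow> nat \<Rightarrow> nat" where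
  "num_perms m n =
     card {\<pi>. \<pi> permutes {1..n} \<and> avoids_132 n \<pi> \<and> bounded_steps m n \<pi>}"

(* Meaningful only where the sequence converges; otherwise lim is unspecified. *)
definition growth_constant :: "nat \<Rightarrow> real" where
  "growth_constant m = lim (\<lambda>n. root n (real (num_perms m n)))"

definition catalan :: "nat \<Rightarrow> real" where
  "catalan j = 1 / (real j + 1) * real ((2 * j) choose j)"

end

(*
  A 132-avoiding permutation is L n R with every entry of L above every entry of R. If the steps are
  bounded by m and R is nonempty, then |L| < m; so every such permutation is obtained from the
  one-element permutation by a word of operations "append a new maximum" and "put L and a new maximum in
  front of sigma" (|L| < m), and whether an operation is allowed depends only on the state
  (n - first entry, n - last entry).

  Growth below 4: dropping the admissibility conditions, the words have generating function
  1/(1 - x - sum_{s<m} C_s x^(s+1)), and at x = 1/4 the subtracted sum is less than 3/4.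

  Existence of the limit: once a coordinate of the state reaches m, only one kind of operation remains
  available. Up to a bounded number of operations a word is therefore a loop at the state (0,1) followed
  by a word using a single kind of operation. Loops and words of front operations returning to first
  coordinate 0 are closed under concatenation, so each provides a lower bound for the growth rate, and
  the decomposition bounds the count by a polynomial times the n-th power of the largest of these rates.
  The words "put L and a maximum in front, put a maximum in front" with |L| = m - 1 give the Catalan lower bound.
*)
theory Submission
  imports Defs "HOL-Computational_Algebra.Formal_Power_Series"
begin

section \<open>132-avoiding lists\<close>

text \<open>The head is tested as the smallest entry of a pattern against all pairs of later
  positions, so that rules for append and shift follow by structural induction.\<close>

fun avoid132 :: "nat list \<Rightarrow> bool" where
  "avoid132 [] \<longleftrightarrow> True"
| "avoid132 (a # xs) \<longleftrightarrow> sorted_wrt (\<lambda>b c. \<not> (a < c \<and> c < b)) xs \<and> avoid132 xs"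

lemma avoid132_append:
  "avoid132 (xs @ ys) \<longleftrightarrow> avoid132 xs \<and> avoid132 ys \<and>
     (\<forall>a\<in>set xs. sorted_wrt (\<lambda>b c. \<not> (a < c \<and> c < b)) ys) \<and>
     sorted_wrt (\<lambda>a b. \<forall>c\<in>set ys. \<not> (a < c \<and> c < b)) xs"
  by (induction xs) (auto simp: sorted_wrt_append)

lemma avoid132_map_add: "avoid132 (map (\<lambda>x. x + r) xs) \<longleftrightarrow> avoid132 xs"
  by (induction xs) (auto simp: sorted_wrt_map)

lemma avoid132_conv_nth:
  "avoid132 xs \<longleftrightarrow>
     (\<forall>i j k. i < j \<longrightarrow> j < k \<longrightarrow> k < length xs \<longrightarrow> \<not> (xs ! i < xs ! k \<and> xs ! k < xs ! j))"
proof (induction xs)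
  case (Cons a xs)
  have "(\<forall>i j k. i < j \<longrightarrow> j < k \<longrightarrow> k < length (a # xs) \<longrightarrow>
           \<not> ((a # xs) ! i < (a # xs) ! k \<and> (a # xs) ! k < (a # xs) ! j)) \<longleftrightarrow>
        (\<forall>i j k. i < Suc j \<longrightarrow> j < k \<longrightarrow> k < length xs \<longrightarrow>
           \<not> ((a # xs) ! i < xs ! k \<and> xs ! k < xs ! j))" (is "?A \<longleftrightarrow> ?B")
  proof
    assume A: ?A
    show ?B
    proof (intro allI impI)
      fix i j k assume "i < Suc j" "j < k" "k < length xs"
      then show "\<not> ((a # xs) ! i < xs ! k \<and> xs ! k < xs ! j)"
        using A[rule_format, of i "Suc j" "Suc k"] by simp
    qed
  next
    assume B: ?B
    show ?A
    proof (intro allI impI)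
      fix i j k assume "i < j" "j < k" "k < length (a # xs)"
      then show "\<not> ((a # xs) ! i < (a # xs) ! k \<and> (a # xs) ! k < (a # xs) ! j)"
        using B[rule_format, of i "j - 1" "k - 1"] by (cases j; cases k) auto
    qed
  qed
  also have "\<dots> \<longleftrightarrow> (\<forall>j k. j < k \<longrightarrow> k < length xs \<longrightarrow> \<not> (a < xs ! k \<and> xs ! k < xs ! j)) \<and>
     (\<forall>i j k. i < j \<longrightarrow> j < k \<longrightarrow> k < length xs \<longrightarrow> \<not> (xs ! i < xs ! k \<and> xs ! k < xs ! j))"
    (is "_ \<longleftrightarrow> ?C \<and> ?D")
  proof
    assume B: ?B
    show "?C \<and> ?D"
    proof (intro conjI allI impI)
      fix j k assume "j < k" "k < length xs"
      then show "\<not> (a < xs ! k \<and> xs ! k < xs ! j)"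
        using B[rule_format, of 0 j k] by simp
    next
      fix i j k assume "i < j" "j < k" "k < length xs"
      then show "\<not> (xs ! i < xs ! k \<and> xs ! k < xs ! j)"
        using B[rule_format, of "Suc i" j k] by simp
    qed
  next
    assume "?C \<and> ?D"
    then show ?B by (auto simp: nth_Cons' less_Suc_eq_0_disj)
  qed
  also have "\<dots> \<longleftrightarrow> avoid132 (a # xs)"
    using Cons.IH by (simp add: sorted_wrt_iff_nth_less)
  finally show ?case by simp
qed simp

definition Av :: "nat \<Rightarrow> nat list set" where
  "Av n = {xs. distinct xs \<and> set xs = {1..n} \<and> avoid132 xs}"

lemma Av_length: "xs \<in> Av n \<Longrightarrow> length xs = n"
  unfolding Av_def using distinct_card by fastforce

lemma Av_distinct: "xs \<in> Av n \<Longrightarrow> distinct xs"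
  and Av_set: "xs \<in> Av n \<Longrightarrow> set xs = {1..n}"
  and Av_avoid: "xs \<in> Av n \<Longrightarrow> avoid132 xs"
  by (auto simp: Av_def)

lemma finite_Av: "finite (Av n)"
proof (rule finite_subset)
  show "Av n \<subseteq> {xs. set xs \<subseteq> {1..n} \<and> length xs = n}"
    using Av_length Av_set by blast
qed (simp add: finite_lists_length_eq)

lemma Av_0: "Av 0 = {[]}"
  by (auto simp: Av_def)

lemma Av_1: "Av 1 = {[1]}"
proof -
  have "xs = [1]" if "xs \<in> Av 1" for xs
    using Av_length[OF that] Av_set[OF that] by (cases xs) auto
  moreover have "[1] \<in> Av 1" by (simp add: Av_def)
  ultimately show ?thesis by blast
qed

section \<open>Splitting a 132-avoider at its maximum\<close>

definition glue :: "nat list \<Rightarrow> nat list \<Rightarrow> nat list" where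
  "glue L R = map (\<lambda>x. x + length R) L @ Suc (length L + length R) # R"

lemma length_glue [simp]: "length (glue L R) = Suc (length L + length R)"
  by (simp add: glue_def)

lemma image_add_atLeastAtMost_1: "(\<lambda>x. x + r) ` {1..k} = {Suc r..k + (r::nat)}"
  by (simp add: image_add_atLeastAtMost')

text \<open>No pattern straddles the parts: its last entry would have to exceed its first, but
  entries of \<open>R\<close> lie below those of the shifted \<open>L\<close>, and the maximum can
  only be the middle value in height if something exceeds it.\<close>

lemma glue_in_Av:
  assumes L: "L \<in> Av k" and R: "R \<in> Av r"
  shows "glue L R \<in> Av (Suc (k + r))"
proof -
  have len: "length L = k" "length R = r"
    using assms Av_length by blast+
  have sL: "set (map (\<lambda>x. x + r) L) = {Suc r..k + r}"
    using Av_set[OF L] image_add_atLeastAtMost_1 by simp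
  have sR: "set R = {1..r}" by (rule Av_set[OF R])
  have "distinct (map (\<lambda>x. x + r) L)"
    using Av_distinct[OF L] by (simp add: distinct_map)
  then have "distinct (glue L R)"
    unfolding glue_def len distinct_append sL using Av_distinct[OF R] sR by auto
  moreover have "set (glue L R) = {1..Suc (k + r)}"
    unfolding glue_def len set_append sL using sR by auto
  moreover have "avoid132 (glue L R)"
  proof -
    have 1: "sorted_wrt (\<lambda>b c. \<not> (a < c \<and> c < b)) (Suc (k + r) # R)"
      if "a \<in> set (map (\<lambda>x. x + r) L)" for a
    proof -
      \<comment> \<open>The trivially true relation is upgraded to the required one, which follows
        from the ranges of the values alone.\<close>
      have "sorted_wrt (\<lambda>b c. True) R" by (simp add: sorted_wrt_iff_nth_less)
      then have "sorted_wrt (\<lambda>b c. \<not> (a < c \<and> c < b)) R"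
        by (rule sorted_wrt_mono_rel[rotated]) (use that sL sR in auto)
      then show ?thesis using that sL sR by auto
    qed
    have "sorted_wrt (\<lambda>a b. True) (map (\<lambda>x. x + r) L)" by (simp add: sorted_wrt_iff_nth_less)
    then have 2: "sorted_wrt (\<lambda>a b. \<forall>c\<in>set (Suc (k + r) # R). \<not> (a < c \<and> c < b)) (map (\<lambda>x. x + r) L)"
      by (rule sorted_wrt_mono_rel[rotated]) (use sL sR in auto)
    have "sorted_wrt (\<lambda>b c. True) R" by (simp add: sorted_wrt_iff_nth_less)
    then have "sorted_wrt (\<lambda>b c. \<not> (Suc (k + r) < c \<and> c < b)) R"
      by (rule sorted_wrt_mono_rel[rotated]) (use sR in auto)
    then show ?thesis
      unfolding glue_def len avoid132_append
      using 1 2 Av_avoid[OF L] Av_avoid[OF R] by (simp add: avoid132_map_add)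
  qed
  ultimately show ?thesis by (simp add: Av_def)
qed

text \<open>An entry left of the maximum and below some entry right of it would form a 132 pattern
  with the maximum between them. So all left values exceed all right values, \<open>R\<close> fills
  an initial interval, and lowering the left part by \<open>r\<close> gives
  \<open>L\<close>.\<close>

lemma Av_Suc_glue:
  assumes xs: "xs \<in> Av (Suc n)"
  obtains L R k r where "k + r = n" "L \<in> Av k" "R \<in> Av r" "xs = glue L R"
proof -
  have "Suc n \<in> set xs" using Av_set[OF xs] by simp
  then obtain L' R where xs_eq: "xs = L' @ Suc n # R" by (meson split_list)
  have d: "distinct L'" "distinct R" "set L' \<inter> set R = {}" "Suc n \<notin> set L'" "Suc n \<notin> set R"
    using Av_distinct[OF xs] xs_eq by auto
  have un: "set L' \<union> set R = {1..n}"
  proof -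
    have "insert (Suc n) (set L' \<union> set R) = insert (Suc n) {1..n}"
      using Av_set[OF xs] xs_eq by (auto simp: atLeastAtMostSuc_conv)
    moreover have "Suc n \<notin> set L' \<union> set R" "Suc n \<notin> {1..n}" using d by auto
    ultimately show ?thesis using insert_ident by metis
  qed
  have sub: "x \<in> {1..n}" if "x \<in> set L' \<or> x \<in> set R" for x
    using that unfolding un[symmetric] by blast
  have av: "avoid132 L'" "avoid132 R" "\<forall>a\<in>set L'. sorted_wrt (\<lambda>b c. \<not> (a < c \<and> c < b)) (Suc n # R)"
    using Av_avoid[OF xs] xs_eq by (auto simp: avoid132_append)
  have gt: "c < a" if "a \<in> set L'" "c \<in> set R" for a c
  proof -
    have "\<not> (a < c \<and> c < Suc n)" using av(3) that by auto
    moreover have "c < Suc n" using sub[of c] that by auto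
    moreover have "a \<noteq> c" using that d by auto
    ultimately show ?thesis by simp
  qed
  define r where "r = length R"
  have cR: "card (set R) = r" using d(2) by (simp add: distinct_card r_def)
  have sR: "set R = {1..r}"
  proof -
    \<comment> \<open>The right part is closed downwards, since left values exceed every right
      value.\<close>
    have down: "y \<in> set R" if "x \<in> set R" "1 \<le> y" "y \<le> x" for x y
    proof -
      have "y \<in> set L' \<union> set R" using sub[of x] that unfolding un by auto
      then show ?thesis using gt that by force
    qed
    show ?thesis
    proof (cases "R = []")
      case True then show ?thesis by (simp add: r_def)
    next
      case False
      define M where "M = Max (set R)"
      have "M \<in> set R" using False by (simp add: M_def)
      have "set R = {1..M}"
      proof (intro subset_antisym subsetI)
        fix x assume "x \<in> set R"
        then show "x \<in> {1..M}" using sub[of x] by (simp add: M_def)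
      next
        fix x assume "x \<in> {1..M}"
        then show "x \<in> set R" using down[OF \<open>M \<in> set R\<close>] by simp
      qed
      then show ?thesis using cR by simp
    qed
  qed
  have rn: "r \<le> n"
  proof -
    have "card (set R) \<le> card {1..n}" by (intro card_mono subsetI) (use sub in simp_all)
    then show ?thesis using cR by simp
  qed
  have sL: "set L' = {Suc r..n}"
  proof -
    have "set L' = {1..n} - set R" unfolding un[symmetric] using d(3) by blast
    also have "\<dots> = {Suc r..n}" unfolding sR by auto
    finally show ?thesis .
  qed
  define L where "L = map (\<lambda>x. x - r) L'"
  have L'_eq: "L' = map (\<lambda>x. x + r) L"
    unfolding L_def map_map by (rule map_idI[symmetric]) (simp add: sL)
  have "set L = {1..n - r}"
  proof -
    have "(\<lambda>x. x - r) ` {Suc r..n} = {1..n - r}"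
    proof safe
      fix y assume "y \<in> {1..n - r}"
      then show "y \<in> (\<lambda>x. x - r) ` {Suc r..n}" by (intro image_eqI[of _ _ "y + r"]) auto
    qed auto
    then show ?thesis by (simp add: L_def sL)
  qed
  moreover have "distinct L" using d(1) unfolding L'_eq distinct_map by simp
  moreover have "avoid132 L" using av(1) unfolding L'_eq avoid132_map_add .
  ultimately have LA: "L \<in> Av (n - r)" by (simp add: Av_def)
  have RA: "R \<in> Av r" using sR d av by (simp add: Av_def)
  have "xs = glue L R"
    using Av_length[OF LA] rn unfolding xs_eq glue_def L'_eq r_def[symmetric] by simp
  then show ?thesis using that[of "n - r" r L R] LA RA rn by simp
qed

text \<open>The maximum occurs once, so its position separates the two parts; equal right parts give
  equal shifts, and shifting is injective.\<close>

lemma glue_inject: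
  assumes "L \<in> Av k" "R \<in> Av r" "L' \<in> Av k'" "R' \<in> Av r'" "glue L R = glue L' R'"
  shows "L = L' \<and> R = R'"
proof -
  have len: "length L = k" "length R = r" "length L' = k'" "length R' = r'"
    using assms Av_length by blast+
  have s: "k + r = k' + r'" using arg_cong[OF assms(5), of length] len by simp
  have "Suc (k + r) \<notin> set (map (\<lambda>x. x + r) L)" "Suc (k + r) \<notin> set R"
    using Av_set[OF assms(1)] Av_set[OF assms(2)] by auto
  moreover have "map (\<lambda>x. x + r) L @ Suc (k + r) # R = map (\<lambda>x. x + r') L' @ Suc (k + r) # R'"
    using assms(5) unfolding glue_def len s .
  ultimately have eq: "map (\<lambda>x. x + r) L = map (\<lambda>x. x + r') L'" "R = R'"
    by (simp_all add: append_Cons_eq_iff)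
  then have "r = r'" using len by simp
  moreover have "inj (\<lambda>x. x + r)" by (simp add: inj_def)
  ultimately show ?thesis using eq by (simp add: inj_map_eq_map)
qed

text \<open>Two additive inequalities stand for the absolute value, since subtraction on
  \<open>nat\<close> truncates.\<close>

definition Avb :: "nat \<Rightarrow> nat \<Rightarrow> nat list set" where
  "Avb m n = {xs \<in> Av n. successively (\<lambda>x y. x \<le> y + m \<and> y \<le> x + m) xs}"

section \<open>From permutations as functions to one-line notation\<close>

lemma successively_map_upt:
  "successively P (map f [1..<Suc n]) \<longleftrightarrow> (\<forall>i. 1 \<le> i \<and> i < n \<longrightarrow> P (f i) (f (Suc i)))"
proof (induction n)
  case (Suc n)
  have "successively P (map f [1..<Suc (Suc n)]) \<longleftrightarrow> successively P (map f [1..<Suc n]) \<and> (n \<ge> 1 \<longrightarrow> P (f n) (f (Suc n)))"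
    by (cases n) (auto simp: successively_append_iff)
  also have "\<dots> \<longleftrightarrow> (\<forall>i. 1 \<le> i \<and> i < Suc n \<longrightarrow> P (f i) (f (Suc i)))"
    unfolding Suc by (auto simp: less_Suc_eq)
  finally show ?case .
qed simp

lemma num_perms_eq_card_Avb: "num_perms m n = card (Avb m n)"
proof -
  let ?S = "{\<pi>. \<pi> permutes {1..n} \<and> avoids_132 n \<pi> \<and> bounded_steps m n \<pi>}"
  let ?f = "\<lambda>\<pi>::nat \<Rightarrow> nat. map \<pi> [1..<Suc n]"
  have nth: "?f \<pi> ! i = \<pi> (Suc i)" if "i < n" for \<pi> i
    using that by (simp del: upt_Suc)
  have av: "avoid132 (?f \<pi>) \<longleftrightarrow> avoids_132 n \<pi>" for \<pi>
  proof
    assume A: "avoid132 (?f \<pi>)"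
    show "avoids_132 n \<pi>" unfolding avoids_132_def
    proof (intro notI, elim exE conjE)
      fix i j k assume "1 \<le> i" "i < j" "j < k" "k \<le> n" "\<pi> i < \<pi> k" "\<pi> k < \<pi> j"
      moreover from this have "i - 1 < j - 1" "j - 1 < k - 1" "k - 1 < n" by auto
      ultimately show False
        using A[unfolded avoid132_conv_nth, rule_format, of "i - 1" "j - 1" "k - 1"]
        by (simp add: nth del: upt_Suc)
    qed
  next
    assume A: "avoids_132 n \<pi>"
    show "avoid132 (?f \<pi>)" unfolding avoid132_conv_nth
    proof (intro allI impI notI)
      fix i j k assume H: "i < j" "j < k" "k < length (?f \<pi>)" "?f \<pi> ! i < ?f \<pi> ! k \<and> ?f \<pi> ! k < ?f \<pi> ! j"
      then have "k < n" "j < n" "i < n" by (simp_all del: upt_Suc)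
      then have "\<pi> (Suc i) < \<pi> (Suc k)" "\<pi> (Suc k) < \<pi> (Suc j)" using H(4) by (simp_all only: nth)
      then show False using A H(1,2) \<open>k < n\<close> unfolding avoids_132_def
        by (metis One_nat_def Suc_le_eq Suc_less_eq zero_less_Suc)
    qed
  qed
  have st: "successively (\<lambda>x y. x \<le> y + m \<and> y \<le> x + m) (?f \<pi>) \<longleftrightarrow> bounded_steps m n \<pi>" for \<pi>
    unfolding successively_map_upt bounded_steps_def by (auto simp: abs_le_iff)
  have "bij_betw ?f ?S (Avb m n)"
  proof (rule bij_betw_imageI)
    show "inj_on ?f ?S"
    proof (rule inj_onI)
      fix \<pi> \<sigma> assume H: "\<pi> \<in> ?S" "\<sigma> \<in> ?S" "?f \<pi> = ?f \<sigma>"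
      have "\<pi> i = \<sigma> i" for i
      proof (cases "i \<in> {1..n}")
        case True
        then show ?thesis using H(3) by (auto simp del: upt_Suc)
      next
        case False
        then show ?thesis using H(1,2) by (auto simp: permutes_def)
      qed
      then show "\<pi> = \<sigma>" by blast
    qed
    show "?f ` ?S = Avb m n"
    proof (intro subset_antisym subsetI)
      fix xs assume "xs \<in> ?f ` ?S"
      then obtain \<pi> where p: "\<pi> \<in> ?S" "xs = ?f \<pi>" by blast
      then have pp: "\<pi> permutes {1..n}" by simp
      have u: "set [1..<Suc n] = {1..n}" by auto
      have "set xs = {1..n}" unfolding p(2) set_map u by (rule permutes_image[OF pp])
      moreover have "distinct xs"
        unfolding p(2) distinct_map u using permutes_inj_on[OF pp] by (simp del: upt_Suc)
      ultimately show "xs \<in> Avb m n"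
        using p av[of \<pi>] st[of \<pi>] by (simp add: Avb_def Av_def del: upt_Suc)
    next
      fix xs assume xs: "xs \<in> Avb m n"
      then have xA: "xs \<in> Av n" by (simp add: Avb_def)
      have len: "length xs = n" by (rule Av_length[OF xA])
      \<comment> \<open>Points outside \<open>{1..n}\<close> are fixed, as \<open>permutes\<close>
        demands.\<close>
      define \<pi> where "\<pi> i = (if i \<in> {1..n} then xs ! (i - 1) else i)" for i
      have f: "?f \<pi> = xs"
        using len by (intro nth_equalityI) (auto simp: \<pi>_def simp del: upt_Suc)
      have u: "set [1..<Suc n] = {1..n}" by auto
      have "\<pi> ` {1..n} = {1..n}"
        using Av_set[OF xA] unfolding f[symmetric] set_map u .
      moreover have "inj_on \<pi> {1..n}"
        using Av_distinct[OF xA] unfolding f[symmetric] distinct_map u by blast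
      ultimately have "bij_betw \<pi> {1..n} {1..n}" by (simp add: bij_betw_def)
      then have "\<pi> permutes {1..n}"
        by (rule bij_imp_permutes) (auto simp: \<pi>_def)
      then have "\<pi> \<in> ?S"
        using xs av[of \<pi>] st[of \<pi>] unfolding f Avb_def Av_def by simp
      then show "xs \<in> ?f ` ?S" using f by force
    qed
  qed
  then show ?thesis unfolding num_perms_def by (rule bij_betw_same_card)
qed

section \<open>Catalan numbers\<close>

text \<open>The Catalan convolution: splitting at the maximum is a bijection, with \<open>k\<close>
  the number of entries before it.\<close>

lemma card_Av_Suc: "card (Av (Suc n)) = (\<Sum>k=0..n. card (Av k) * card (Av (n - k)))"
proof -
  let ?T = "SIGMA k:{0..n}. Av k \<times> Av (n - k)"
  have "bij_betw (\<lambda>(k, L, R). glue L R) ?T (Av (Suc n))"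
  proof (rule bij_betw_imageI)
    show "inj_on (\<lambda>(k, L, R). glue L R) ?T"
    proof (rule inj_onI)
      fix p q assume pq: "p \<in> ?T" "q \<in> ?T" "(\<lambda>(k, L, R). glue L R) p = (\<lambda>(k, L, R). glue L R) q"
      obtain k L R k' L' R' where e: "p = (k, L, R)" "q = (k', L', R')" by (metis prod_cases3)
      have H: "L \<in> Av k" "R \<in> Av (n - k)" "L' \<in> Av k'" "R' \<in> Av (n - k')" "glue L R = glue L' R'"
        using pq unfolding e by simp_all
      show "p = q"
        using glue_inject[OF H] Av_length[OF H(1)] Av_length[OF H(3)] unfolding e by simp
    qed
    show "(\<lambda>(k, L, R). glue L R) ` ?T = Av (Suc n)"
    proof (intro subset_antisym subsetI)
      fix xs assume "xs \<in> (\<lambda>(k, L, R). glue L R) ` ?T"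
      then obtain k L R where "k \<le> n" "L \<in> Av k" "R \<in> Av (n - k)" "xs = glue L R" by auto
      then show "xs \<in> Av (Suc n)" using glue_in_Av[of L k R "n - k"] by simp
    next
      fix xs assume "xs \<in> Av (Suc n)"
      then obtain L R k r where "k + r = n" "L \<in> Av k" "R \<in> Av r" "xs = glue L R"
        by (rule Av_Suc_glue)
      then show "xs \<in> (\<lambda>(k, L, R). glue L R) ` ?T"
        by (intro image_eqI[of _ _ "(k, L, R)"]) auto
    qed
  qed
  then have "card (Av (Suc n)) = card ?T" by (simp add: bij_betw_same_card)
  also have "\<dots> = (\<Sum>k=0..n. card (Av k \<times> Av (n - k)))"
    by (rule card_SigmaI) (auto intro: finite_Av)
  finally show ?thesis by (simp add: card_cartesian_product)
qed

text \<open>Absorption is applied twice, with the symmetry of row \<open>2 * n + 1\<close> in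
  between; the extra factor \<open>Suc n\<close> makes the second application possible and is
  cancelled at the end.\<close>

lemma central_binomial_Suc:
  "(real n + 1) * real ((2 * Suc n) choose (Suc n)) = (4 * real n + 2) * real ((2 * n) choose n)"
proof -
  have "Suc n * (Suc n * ((2 * Suc n) choose (Suc n))) = Suc n * (Suc (2 * n + 1) * ((2 * n + 1) choose n))"
    using Suc_times_binomial[of n "2 * n + 1"] by (simp del: binomial_Suc_Suc)
  also have "(2 * n + 1) choose n = (2 * n + 1) choose Suc n"
    using binomial_symmetric[of n "2 * n + 1"] by (simp del: binomial_Suc_Suc)
  also have "Suc n * (Suc (2 * n + 1) * ((2 * n + 1) choose Suc n)) =
      Suc (2 * n + 1) * (Suc (2 * n) * ((2 * n) choose n))"
    using arg_cong[OF Suc_times_binomial[of n "2 * n"], of "(*) (Suc (2 * n + 1))"]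
    by (simp only: mult.left_commute Suc_eq_plus1)
  also have "\<dots> = Suc n * ((4 * n + 2) * ((2 * n) choose n))"
    by (simp add: algebra_simps)
  finally have "Suc n * ((2 * Suc n) choose (Suc n)) = (4 * n + 2) * ((2 * n) choose n)"
    by (simp only: mult_cancel1) simp
  from arg_cong[OF this, of real] show ?thesis
    by (simp only: of_nat_mult of_nat_add of_nat_Suc of_nat_numeral) (simp add: add.commute)
qed

lemma catalan_Suc: "(real n + 2) * catalan (Suc n) = (4 * real n + 2) * catalan n"
proof -
  have "(real n + 1) * ((real n + 2) * catalan (Suc n)) = (real n + 1) * real ((2 * Suc n) choose (Suc n))"
    by (simp add: catalan_def field_simps)
  also have "\<dots> = (real n + 1) * ((4 * real n + 2) * catalan n)"
    unfolding central_binomial_Suc by (simp add: catalan_def field_simps)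
  finally show ?thesis by simp
qed

text \<open>The generating function \<open>C\<close> satisfies \<open>C = 1 + X C\<^sup>2\<close>, so \<open>S = 1 - 2 X C\<close> has \<open>S\<^sup>2 = 1 - 4 X\<close>;
  differentiating gives \<open>(1 - 4 X) S' = - 2 S\<close>, a two-term recurrence for the coefficients.\<close>

lemma card_Av_recurrence:
  "(real n + 2) * real (card (Av (Suc n))) = (4 * real n + 2) * real (card (Av n))"
proof -
  define C :: "real fps" where "C = Abs_fps (\<lambda>n. real (card (Av n)))"
  have C_eq: "C = 1 + fps_X * (C * C)"
  proof (rule fps_ext)
    fix n
    show "fps_nth C n = fps_nth (1 + fps_X * (C * C)) n"
    proof (cases n)
      case (Suc k)
      have "fps_nth (C * C) k = real (card (Av n))"
        unfolding fps_mult_nth Suc card_Av_Suc by (simp add: C_def)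
      then show ?thesis using Suc by (simp add: C_def)
    qed (simp add: C_def Av_0)
  qed
  define S where "S = 1 - 2 * fps_X * C"
  have S2: "S * S = 1 - 4 * fps_X"
  proof -
    have "S * S = 1 - 4 * fps_X * C + 4 * fps_X * (fps_X * (C * C))"
      by (simp add: S_def algebra_simps)
    also have "fps_X * (C * C) = C - 1" using C_eq by (simp add: algebra_simps)
    finally show ?thesis by (simp add: algebra_simps)
  qed
  have "fps_deriv (S * S) = - 4"
    unfolding S2 by simp
  then have "2 * (S * fps_deriv S) = 2 * (- 2)" by (simp add: algebra_simps)
  then have "S * fps_deriv S = - 2" by (subst (asm) mult_left_cancel) simp_all
  then have "S * S * fps_deriv S = - 2 * S" unfolding mult.assoc by simp
  then have eq: "(1 - 4 * fps_X) * fps_deriv S = - 2 * S" unfolding S2 .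
  have S_nth: "fps_nth S (Suc k) = - 2 * real (card (Av k))" for k
  proof -
    have "S = 1 - fps_const 2 * (fps_X * C)" by (simp add: S_def numeral_fps_const mult.assoc)
    then show ?thesis by (simp add: C_def)
  qed
  have "(1 - 4 * fps_X) * fps_deriv S = fps_deriv S - fps_const 4 * (fps_X * fps_deriv S)"
    by (simp add: algebra_simps numeral_fps_const)
  moreover have "- 2 * S = fps_const (- 2) * S" by (simp add: numeral_fps_const)
  \<comment> \<open>At index \<open>Suc n\<close> only coefficients of \<open>S\<close> beyond the
    constant term enter, so \<open>S_nth\<close> covers all of them.\<close>
  ultimately have "fps_nth (fps_deriv S - fps_const 4 * (fps_X * fps_deriv S)) (Suc n) =
      fps_nth (fps_const (- 2) * S) (Suc n)"
    using eq by simp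
  then show ?thesis by (simp add: S_nth) (simp add: algebra_simps)
qed

lemma card_Av: "real (card (Av n)) = catalan n"
proof (induction n)
  case 0
  then show ?case by (simp add: Av_0 catalan_def)
next
  case (Suc n)
  have "(real n + 2) * real (card (Av (Suc n))) = (real n + 2) * catalan (Suc n)"
    unfolding card_Av_recurrence catalan_Suc Suc ..
  then show ?case by simp
qed

text \<open>The sum telescopes: each term is the drop of the central binomial divided by
  \<open>2 * 4 ^ s\<close>. The value stays below 1/2, which keeps the growth strictly below
  4.\<close>

lemma catalan_sum:
  "(\<Sum>s<m. catalan s * (1/4) ^ Suc s) = 1/2 - real ((2 * m) choose m) / (2 * 4 ^ m)"
proof (induction m)
  case (Suc m)
  have e: "real ((2 * Suc m) choose (Suc m)) = (4 * real m + 2) * real ((2 * m) choose m) / (real m + 1)"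
    using central_binomial_Suc[of m] by (simp add: field_simps)
  have "1/2 - B / (2 * p) + 1 / (x + 1) * B * (1 / (4 * p)) = 1/2 - (4 * x + 2) * B / (x + 1) / (2 * (4 * p))"
    if "x \<ge> 0" "p > 0" for B p x :: real
    using that by (simp add: divide_simps) (simp add: algebra_simps)
  from this[of "real m" "4 ^ m" "real ((2 * m) choose m)"]
  have "1/2 - real ((2 * m) choose m) / (2 * 4 ^ m) + catalan m * (1/4) ^ Suc m =
        1/2 - real ((2 * Suc m) choose (Suc m)) / (2 * 4 ^ Suc m)"
    unfolding e catalan_def by (simp add: power_divide)
  then show ?case using Suc by simp
qed simp

text \<open>Row \<open>2 * j\<close> of Pascal's triangle has \<open>2 * j + 1\<close> entries with
  sum \<open>4 ^ j\<close>, and the central one is the largest.\<close>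

lemma catalan_lower_bound: "4 ^ j \<le> (real j + 1) * (2 * real j + 1) * catalan j"
proof -
  have "real (4 ^ j) \<le> real ((2 * j + 1) * ((2 * j) choose j))"
  proof (rule of_nat_mono)
    have "(4::nat) ^ j = 2 ^ (2 * j)" by (simp add: power_mult)
    also have "\<dots> = (\<Sum>k\<le>2 * j. (2 * j) choose k)" by (simp add: choose_row_sum)
    also have "\<dots> \<le> (\<Sum>k\<le>2 * j. (2 * j) choose j)"
      by (rule sum_mono) (use binomial_maximum'[of j] in simp)
    finally show "4 ^ j \<le> (2 * j + 1) * ((2 * j) choose j)" by simp
  qed
  also have "real ((2 * j + 1) * ((2 * j) choose j)) = (2 * real j + 1) * real ((2 * j) choose j)"
    by (simp add: algebra_simps)
  also have "real ((2 * j) choose j) = (real j + 1) * catalan j"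
    by (simp add: catalan_def)
  finally show ?thesis by (simp add: mult_ac)
qed

section \<open>Permutations as words of operations\<close>

text \<open>\<open>None\<close> appends a new maximum; \<open>Some L\<close> puts \<open>L\<close> and a new maximum in front.\<close>

type_synonym op = "nat list option"

text \<open>The number of entries that an operation adds.\<close>

fun wt1 :: "op \<Rightarrow> nat" where
  "wt1 None = 1"
| "wt1 (Some L) = Suc (length L)"

definition wt :: "op list \<Rightarrow> nat" where
  "wt w = sum_list (map wt1 w)"

lemma wt_simps [simp]: "wt [] = 0" "wt (x # w) = wt1 x + wt w" "wt (u @ w) = wt u + wt w"
  by (simp_all add: wt_def)

lemma wt1_pos [simp]: "0 < wt1 x"
  by (cases x) auto

lemma wt_eq_0_iff [simp]: "wt w = 0 \<longleftrightarrow> w = []"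
  by (cases w) (auto simp: add_pos_nonneg)

lemma length_le_wt: "length w \<le> wt w"
proof (induction w)
  case (Cons x w)
  then show ?case using wt1_pos[of x] by (simp del: wt1_pos)
qed simp

text \<open>A state of a permutation of length \<open>n\<close> is \<open>(n - first entry, n - last entry)\<close>;
  \<open>deficit L\<close> is the first component after putting \<open>L\<close> and a new maximum in front.\<close>

fun deficit :: "nat list \<Rightarrow> nat" where
  "deficit [] = 0"
| "deficit (x # xs) = Suc (length (x # xs)) - x"

lemma deficit_le: "L \<in> Av k \<Longrightarrow> deficit L \<le> k"
  using Av_length Av_set by (cases L) fastforce+

fun step :: "nat \<times> nat \<Rightarrow> op \<Rightarrow> nat \<times> nat" where
  "step (f, l) None = (Suc f, 0)"
| "step (f, l) (Some L) = (deficit L, Suc (length L + l))"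

text \<open>These are the new steps at the maximum: \<open>l + 1\<close> from the last entry up to
  an appended maximum, and \<open>length L + f + 1\<close> down from a maximum put in front. Steps
  inside \<open>L\<close> and from \<open>L\<close> to the maximum are then automatically
  short.\<close>

fun ok :: "nat \<Rightarrow> nat \<times> nat \<Rightarrow> op \<Rightarrow> bool" where
  "ok m (f, l) None \<longleftrightarrow> l < m"
| "ok m (f, l) (Some L) \<longleftrightarrow> L \<in> Av (length L) \<and> length L + f < m"

fun valid :: "nat \<Rightarrow> nat \<times> nat \<Rightarrow> op list \<Rightarrow> bool" where
  "valid m s [] \<longleftrightarrow> True"
| "valid m s (x # w) \<longleftrightarrow> ok m s x \<and> valid m (step s x) w"

abbreviation "run \<equiv> foldl step"

lemma valid_append: "valid m s (u @ w) \<longleftrightarrow> valid m s u \<and> valid m (run s u) w"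
  by (induction u arbitrary: s) auto

fun app :: "nat list \<Rightarrow> op \<Rightarrow> nat list" where
  "app xs None = glue xs []"
| "app xs (Some L) = glue L xs"

text \<open>Words are read from the innermost operation outwards.\<close>

definition build :: "op list \<Rightarrow> nat list" where
  "build w = foldl app [1] w"

lemma build_simps [simp]: "build [] = [1]" "build (w @ [x]) = app (build w) x"
  by (simp_all add: build_def)

section \<open>Effect of one operation on steps and state\<close>

lemma hd_in_Av: "L \<in> Av k \<Longrightarrow> L \<noteq> [] \<Longrightarrow> 1 \<le> hd L \<and> hd L \<le> k"
  using Av_set hd_in_set by fastforce

lemma last_in_Av: "L \<in> Av k \<Longrightarrow> L \<noteq> [] \<Longrightarrow> 1 \<le> last L \<and> last L \<le> k"
  using Av_set last_in_set by fastforce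

lemma successively_glue:
  assumes "L \<in> Av k" "R \<in> Av r"
  shows "successively (\<lambda>x y. x \<le> y + m \<and> y \<le> x + m) (glue L R) \<longleftrightarrow>
     successively (\<lambda>x y. x \<le> y + m \<and> y \<le> x + m) L \<and> successively (\<lambda>x y. x \<le> y + m \<and> y \<le> x + m) R \<and>
     (L \<noteq> [] \<longrightarrow> Suc (k - last L) \<le> m) \<and> (R \<noteq> [] \<longrightarrow> Suc (k + (r - hd R)) \<le> m)"
proof -
  have len: "length L = k" "length R = r"
    using assms Av_length by blast+
  show ?thesis
    using hd_in_Av[OF assms(2)] last_in_Av[OF assms(1)]
    unfolding glue_def len successively_append_iff successively_Cons successively_map
    by (auto simp: last_map)
qed

lemma successively_short:
  assumes "L \<in> Av k" "k \<le> m"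
  shows "successively (\<lambda>x y. x \<le> y + m \<and> y \<le> x + m) L"
proof -
  have "sorted_wrt (\<lambda>x y. True) L" by simp
  then have "sorted_wrt (\<lambda>x y. x \<le> y + m \<and> y \<le> x + m) L"
    by (rule sorted_wrt_mono_rel[rotated]) (use Av_set[OF assms(1)] assms(2) in auto)
  then show ?thesis by (rule successively_if_sorted_wrt)
qed

definition state :: "nat list \<Rightarrow> nat \<times> nat" where
  "state xs = (length xs - hd xs, length xs - last xs)"

text \<open>The steps created by an operation depend on \<open>xs\<close> only through its state, so
  the state suffices to decide admissibility and can be updated on its own.\<close>

lemma app_in_Avb_iff:
  assumes xs: "xs \<in> Av (Suc n)" and "case x of None \<Rightarrow> True | Some L \<Rightarrow> L \<in> Av (length L)"
  shows "app xs x \<in> Avb m (Suc (n + wt1 x)) \<longleftrightarrow> xs \<in> Avb m (Suc n) \<and> ok m (state xs) x"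
    and "state (app xs x) = step (state xs) x"
    and "app xs x \<in> Av (Suc (n + wt1 x))"
proof -
  have ne: "xs \<noteq> []" and len: "length xs = Suc n" using Av_length[OF xs] by auto
  note b = hd_in_Av[OF xs ne] last_in_Av[OF xs ne]
  have "(app xs x \<in> Avb m (Suc (n + wt1 x)) \<longleftrightarrow> xs \<in> Avb m (Suc n) \<and> ok m (state xs) x) \<and>
     state (app xs x) = step (state xs) x \<and> app xs x \<in> Av (Suc (n + wt1 x))"
  proof (cases x)
    case None
    have 0: "[] \<in> Av 0" by (simp add: Av_0)
    have "glue xs [] \<in> Av (Suc (Suc n))" using glue_in_Av[OF xs 0] by simp
    moreover have "state (glue xs []) = step (state xs) None"
      using ne b len by (auto simp: state_def glue_def)
    ultimately show ?thesis
      using successively_glue[OF xs 0, of m] ne xs len None by (auto simp: Avb_def state_def)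
  next
    case (Some L)
    then have L: "L \<in> Av (length L)" using assms(2) by simp
    have "glue L xs \<in> Av (Suc (length L + Suc n))" using glue_in_Av[OF L xs] .
    moreover have "state (glue L xs) = step (state xs) (Some L)"
      using ne b len hd_in_Av[OF L] by (cases L) (auto simp: state_def glue_def)
    moreover have "successively (\<lambda>x y. x \<le> y + m \<and> y \<le> x + m) (glue L xs) \<longleftrightarrow>
       successively (\<lambda>x y. x \<le> y + m \<and> y \<le> x + m) xs \<and> length L + (Suc n - hd xs) < m"
      using successively_glue[OF L xs, of m] successively_short[OF L, of m] ne last_in_Av[OF L] by auto
    ultimately show ?thesis
      using ne xs len L Some by (auto simp: Avb_def state_def add.commute)
  qed
  then show "app xs x \<in> Avb m (Suc (n + wt1 x)) \<longleftrightarrow> xs \<in> Avb m (Suc n) \<and> ok m (state xs) x"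
    "state (app xs x) = step (state xs) x" "app xs x \<in> Av (Suc (n + wt1 x))" by blast+
qed

lemma ok_Some_Av: "ok m s x \<Longrightarrow> case x of None \<Rightarrow> True | Some L \<Rightarrow> L \<in> Av (length L)"
  by (cases s; cases x) auto

lemma build_valid:
  assumes "valid m (0, 0) w"
  shows "build w \<in> Avb m (Suc (wt w)) \<and> state (build w) = run (0, 0) w"
  using assms
proof (induction w rule: rev_induct)
  case Nil
  then show ?case by (simp add: Avb_def Av_1[simplified] state_def)
next
  case (snoc x w)
  then have IH: "build w \<in> Avb m (Suc (wt w))" "state (build w) = run (0, 0) w"
    and x: "ok m (run (0, 0) w) x" by (auto simp: valid_append)
  have A: "build w \<in> Av (Suc (wt w))" using IH by (simp add: Avb_def)
  show ?case
    using app_in_Avb_iff(1)[OF A ok_Some_Av[OF x], of m] app_in_Avb_iff(2)[OF A ok_Some_Av[OF x]] IH x by simp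
qed

text \<open>Strong induction, removing the outermost maximum.\<close>

lemma ex_build:
  assumes "xs \<in> Avb m (Suc n)"
  shows "\<exists>w. valid m (0, 0) w \<and> wt w = n \<and> build w = xs"
  using assms
proof (induction n arbitrary: xs rule: less_induct)
  case (less n)
  have "xs \<in> Av (Suc n)" using less.prems by (simp add: Avb_def)
  then obtain L R k r where LR: "k + r = n" "L \<in> Av k" "R \<in> Av r" "xs = glue L R"
    by (rule Av_Suc_glue)
  have len: "length L = k" "length R = r" using LR Av_length by blast+
  show ?case
  proof (cases "n = 0")
    case True
    then have "xs = [1]" using \<open>xs \<in> Av (Suc n)\<close> Av_1 by simp
    then show ?thesis using True by (intro exI[of _ "[]"]) simp
  next
    case False
    have "\<exists>ys x n'. n = n' + wt1 x \<and> ys \<in> Av (Suc n') \<and> xs = app ys x \<and>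
       (case x of None \<Rightarrow> True | Some L \<Rightarrow> L \<in> Av (length L))"
    \<comment> \<open>An empty right part is read as \<open>None\<close>, a nonempty one as
      \<open>Some L\<close>. Words start from \<open>[1]\<close>, so the permutation operated on is
      never empty and the reading is unique.\<close>
    proof (cases "R = []")
      case True
      then have "r = 0" using len by simp
      then show ?thesis using LR False True
        by (intro exI[of _ L] exI[of _ None] exI[of _ "k - 1"]) auto
    next
      case F: False
      then have "r > 0" using len by auto
      then show ?thesis using LR F len
        by (intro exI[of _ R] exI[of _ "Some L"] exI[of _ "r - 1"]) auto
    qed
    then obtain ys x n' where y: "n = n' + wt1 x" "ys \<in> Av (Suc n')" "xs = app ys x"
      "case x of None \<Rightarrow> True | Some L \<Rightarrow> L \<in> Av (length L)" by blast
    have a: "ys \<in> Avb m (Suc n') \<and> ok m (state ys) x"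
      using app_in_Avb_iff(1)[OF y(2) y(4), of m] less.prems y by simp
    have "n' < n" using y(1) wt1_pos[of x] by linarith
    from less.IH[OF this, of ys] a obtain w where w: "valid m (0, 0) w" "wt w = n'" "build w = ys" by blast
    then have "valid m (0, 0) (w @ [x])"
      using a build_valid[OF w(1)] by (simp add: valid_append)
    then show ?thesis using w y by (intro exI[of _ "w @ [x]"]) simp
  qed
qed

text \<open>The two kinds of operation cannot collide: after \<open>None\<close> nothing follows the
  maximum, after \<open>Some\<close> the nonempty old permutation does.\<close>

lemma app_inject:
  assumes "xs \<in> Av (Suc n)" "ys \<in> Av (Suc n')" "app xs x = app ys y"
    and "case x of None \<Rightarrow> True | Some L \<Rightarrow> L \<in> Av (length L)"
    and "case y of None \<Rightarrow> True | Some L \<Rightarrow> L \<in> Av (length L)"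
  shows "xs = ys \<and> x = y"
proof -
  have 0: "[] \<in> Av 0" by (simp add: Av_0)
  have ne: "xs \<noteq> []" "ys \<noteq> []" using assms(1,2) Av_length by fastforce+
  show ?thesis
  proof (cases x; cases y)
    assume "x = None" "y = None"
    then show ?thesis using glue_inject[OF assms(1) 0 assms(2) 0] assms by simp
  next
    fix M assume H: "x = None" "y = Some M"
    then show ?thesis using glue_inject[OF assms(1) 0 _ assms(2), of M "length M"] assms ne by simp
  next
    fix L assume H: "x = Some L" "y = None"
    then show ?thesis using glue_inject[OF _ assms(1) assms(2) 0, of L "length L"] assms ne by simp
  next
    fix L M assume H: "x = Some L" "y = Some M"
    then show ?thesis using glue_inject[OF _ assms(1) _ assms(2), of L "length L" M "length M"] assms by simp
  qed
qed

lemma build_inject: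
  assumes "valid m (0, 0) u" "valid m (0, 0) w" "build u = build w"
  shows "u = w"
  using assms
proof (induction u arbitrary: w rule: rev_induct)
  case Nil
  have "build [] \<in> Av (Suc 0)" "build w \<in> Av (Suc (wt w))"
    using build_valid[OF Nil(1)] build_valid[OF Nil(2)] by (auto simp: Avb_def)
  then have "wt w = 0" using Nil Av_length by (metis Suc_inject)
  then show ?case by simp
next
  case (snoc x u)
  have "build (u @ [x]) \<in> Av (Suc (wt (u @ [x])))" "build w \<in> Av (Suc (wt w))"
    using build_valid[OF snoc(2)] build_valid[OF snoc(3)] by (auto simp: Avb_def)
  then have "wt w = wt (u @ [x])" using snoc Av_length by (metis Suc_inject)
  then have "w \<noteq> []" using wt1_pos[of x] by (auto simp del: wt1_pos)
  then obtain v y where w: "w = v @ [y]" by (metis rev_exhaust)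
  have u: "valid m (0, 0) u" "ok m (run (0, 0) u) x" and v: "valid m (0, 0) v" "ok m (run (0, 0) v) y"
    using snoc.prems w by (auto simp: valid_append)
  have "build u \<in> Av (Suc (wt u))" "build v \<in> Av (Suc (wt v))"
    using build_valid[OF u(1)] build_valid[OF v(1)] by (auto simp: Avb_def)
  then have "build u = build v \<and> x = y"
    by (rule app_inject[OF _ _ _ ok_Some_Av[OF u(2)] ok_Some_Av[OF v(2)]]) (use snoc.prems w in simp)
  then show ?case using snoc.IH[OF u(1) v(1)] w by simp
qed

definition words :: "nat \<Rightarrow> nat \<times> nat \<Rightarrow> nat \<Rightarrow> op list set" where
  "words m s n = {w. valid m s w \<and> wt w = n}"

text \<open>The shift by one is the single entry of the starting permutation.\<close>

lemma num_perms_Suc: "num_perms m (Suc n) = card (words m (0, 0) n)"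
proof -
  have "bij_betw build (words m (0, 0) n) (Avb m (Suc n))"
    unfolding words_def
  proof (rule bij_betw_imageI)
    show "inj_on build {w. valid m (0, 0) w \<and> wt w = n}"
      by (rule inj_onI) (use build_inject in blast)
    show "build ` {w. valid m (0, 0) w \<and> wt w = n} = Avb m (Suc n)"
      using build_valid ex_build by (fastforce simp: image_iff)
  qed
  then show ?thesis by (simp add: num_perms_eq_card_Avb bij_betw_same_card)
qed

section \<open>Decomposition of words\<close>

definition letters :: "nat \<Rightarrow> op set" where
  "letters m = insert None (Some ` (\<Union>s<m. Av s))"

lemma finite_letters: "finite (letters m)"
  by (simp add: letters_def finite_Av)

lemma ok_in_letters: "ok m s x \<Longrightarrow> x \<in> letters m"
  by (cases s; cases x) (force simp: letters_def)+

lemma valid_subset_letters: "valid m s w \<Longrightarrow> set w \<subseteq> letters m"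
proof (induction w arbitrary: s)
  case (Cons x w)
  then show ?case using ok_in_letters[of m s x] Cons.IH[of "step s x"] by simp
qed simp

lemma finite_wt_letters: "finite {w. set w \<subseteq> letters m \<and> wt w = n}"
proof (rule finite_subset)
  show "{w. set w \<subseteq> letters m \<and> wt w = n} \<subseteq> {w. set w \<subseteq> letters m \<and> length w \<le> n}"
    using length_le_wt by blast
qed (simp add: finite_lists_length_le finite_letters)

lemma finite_words [simp]: "finite (words m s n)"
  by (rule finite_subset[OF _ finite_wt_letters[of m n]]) (auto simp: words_def dest: valid_subset_letters)

text \<open>\<open>ok\<close> is closed downwards in both coordinates and \<open>step\<close> is
  monotone in them.\<close>

lemma valid_mono:
  assumes "f' \<le> f" "l' \<le> l" "valid m (f, l) w"
  shows "valid m (f', l') w \<and> fst (run (f', l') w) \<le> fst (run (f, l) w) \<and>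
         snd (run (f', l') w) \<le> snd (run (f, l) w)"
  using assms
proof (induction w arbitrary: f l f' l')
  case (Cons x w)
  show ?case
  proof (cases x)
    case None
    then show ?thesis using Cons.IH[of "Suc f'" "Suc f" 0 0] Cons.prems by auto
  next
    case (Some L)
    then show ?thesis
      using Cons.IH[of "deficit L" "deficit L" "Suc (length L + l')" "Suc (length L + l)"] Cons.prems by auto
  qed
qed simp

text \<open>No block fits in front any more, and each \<open>None\<close> raises the first
  coordinate further.\<close>

lemma valid_high_first: "m \<le> f \<Longrightarrow> valid m (f, l) w \<Longrightarrow> set w \<subseteq> {None}"
proof (induction w arbitrary: f l)
  case (Cons x w)
  then show ?case using Cons.IH[of "Suc f" 0] by (cases x) auto
qed simp

text \<open>\<open>None\<close> is forbidden here, and front operations only raise the last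
  coordinate.\<close>

lemma valid_high_last: "m \<le> l \<Longrightarrow> valid m (f, l) w \<Longrightarrow> None \<notin> set w"
proof (induction w arbitrary: f l)
  case (Cons x w)
  show ?case
  proof (cases x)
    case (Some L)
    then show ?thesis using Cons.IH[of "Suc (length L + l)" "deficit L"] Cons.prems by simp
  qed (use Cons.prems in simp)
qed simp

text \<open>Front operations neither test the last coordinate nor pass it on to the first.\<close>

lemma valid_no_None:
  assumes "None \<notin> set w"
  shows "(valid m (f, l) w \<longleftrightarrow> valid m (f, l') w) \<and> fst (run (f, l) w) = fst (run (f, l') w)"
  using assms
proof (induction w arbitrary: f l l')
  case (Cons x w)
  then show ?case by (cases x) auto
qed simp

text \<open>The cut is made before the first letter that leads out of the box where both coordinates
  are below \<open>m\<close>; beyond it only one kind of operation can occur.\<close>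

lemma valid_split:
  assumes "valid m (f, l) w" "f < m" "l < m"
  shows "\<exists>w1 w2 f1 l1. w = w1 @ w2 \<and> valid m (f, l) w1 \<and> run (f, l) w1 = (f1, l1) \<and> f1 < m \<and> l1 < m \<and>
           (None \<notin> set w2 \<and> valid m (0, 0) w2 \<or> set w2 \<subseteq> {None})"
  using assms
proof (induction w arbitrary: f l)
  case Nil
  then show ?case by auto
next
  case (Cons x w)
  obtain f' l' where s: "step (f, l) x = (f', l')" by fastforce
  have x: "ok m (f, l) x" and v: "valid m (f', l') w" using Cons.prems s by auto
  show ?case
  proof (cases "f' < m \<and> l' < m")
    case True
    then obtain w1 w2 f1 l1 where "w = w1 @ w2" "valid m (f', l') w1" "run (f', l') w1 = (f1, l1)"
      "f1 < m" "l1 < m" "None \<notin> set w2 \<and> valid m (0, 0) w2 \<or> set w2 \<subseteq> {None}"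
      using Cons.IH[OF v] by blast
    then show ?thesis using x s
      by (intro exI[of _ "x # w1"] exI[of _ w2] exI[of _ f1] exI[of _ l1]) simp
  next
    case False
    have "None \<notin> set (x # w) \<and> valid m (0, 0) (x # w) \<or> set (x # w) \<subseteq> {None}"
    proof (cases x)
      case None
      then have "m \<le> f'" using s False Cons.prems by auto
      then show ?thesis using valid_high_first[OF _ v] None by auto
    next
      case (Some L)
      \<comment> \<open>A front operation can leave the box only through the last
        coordinate.\<close>
      then have "deficit L < m" using x deficit_le[of L "length L"] by auto
      then have "m \<le> l'" using s False Some by auto
      then have "None \<notin> set (x # w)" using valid_high_last[OF _ v] Some by auto
      then show ?thesis using valid_mono[of 0 f 0 l m "x # w"] Cons.prems by simp
    qed
    then show ?thesis using Cons.prems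
      by (intro exI[of _ "[]"] exI[of _ "x # w"] exI[of _ f] exI[of _ l]) simp
  qed
qed

text \<open>No operation leads to \<open>(0, 0)\<close>: \<open>None\<close> makes the first
  coordinate positive, \<open>Some L\<close> the last. The state \<open>(0, 1)\<close> is reached by
  \<open>None\<close> followed by \<open>Some []\<close>, wherever these are allowed.\<close>

definition loops :: "nat \<Rightarrow> nat \<Rightarrow> op list set" where
  "loops m n = {w \<in> words m (0, 1) n. run (0, 1) w = (0, 1)}"

text \<open>The last coordinate may grow here, but front operations ignore it; first coordinate 0 is
  enough to concatenate such words.\<close>

definition descents :: "nat \<Rightarrow> nat \<Rightarrow> op list set" where
  "descents m n = {w \<in> words m (0, 0) n. None \<notin> set w \<and> fst (run (0, 0) w) = 0}"

section \<open>Supermultiplicative counting by concatenation\<close>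

lemma append_eq_append_wt:
  assumes "u @ w = u' @ w'" "wt u = wt u'"
  shows "u = u' \<and> w = w'"
  using assms by (auto simp: append_eq_append_conv2)

text \<open>Concatenation is injective once the weight of the first factor is fixed.\<close>

lemma card_power_le:
  assumes closed: "\<And>u w. u \<in> Z \<Longrightarrow> w \<in> Z \<Longrightarrow> u @ w \<in> Z" and "[] \<in> Z"
    and fin: "\<And>n. finite {w \<in> Z. wt w = n}"
  shows "card {w \<in> Z. wt w = p} ^ k \<le> card {w \<in> Z. wt w = p * k}"
proof (induction k)
  case 0
  have "[] \<in> {w \<in> Z. wt w = 0}" using assms(2) by simp
  then have "card {w \<in> Z. wt w = 0} > 0" using fin[of 0] card_gt_0_iff by blast
  then show ?case by simp
next
  case (Suc k)
  let ?X = "\<lambda>n. {w \<in> Z. wt w = n}"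
  have "card (?X p) ^ Suc k \<le> card (?X p) * card (?X (p * k))"
    using Suc by simp
  also have "\<dots> = card (?X p \<times> ?X (p * k))" by (simp add: card_cartesian_product)
  also have "\<dots> \<le> card (?X (p * Suc k))"
  proof (rule card_inj_on_le)
    show "inj_on (\<lambda>(u, w). u @ w) (?X p \<times> ?X (p * k))"
      by (rule inj_onI) (auto dest: append_eq_append_wt)
    show "(\<lambda>(u, w). u @ w) ` (?X p \<times> ?X (p * k)) \<subseteq> ?X (p * Suc k)"
      using closed by auto
  qed (rule fin)
  finally show ?case .
qed

text \<open>Prefixing \<open>Some []\<close>, of weight 1, moves the start of a loop from
  \<open>(0, 1)\<close> to \<open>(0, 0)\<close>.\<close>

lemma card_loops_power: 
  assumes "0 < m"
  shows "card (loops m p) ^ k \<le> card (words m (0, 0) (Suc (p * k)))"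
proof -
  let ?Z = "{w. valid m (0, 1) w \<and> run (0, 1) w = (0, 1)}"
  have L: "loops m n = {w \<in> ?Z. wt w = n}" for n by (auto simp: loops_def words_def)
  have "card (loops m p) ^ k \<le> card (loops m (p * k))"
    unfolding L
  proof (rule card_power_le)
    show "finite {w \<in> ?Z. wt w = n}" for n
      by (rule finite_subset[OF _ finite_words[of m "(0, 1)" n]]) (auto simp: words_def)
  qed (auto simp: valid_append)
  also have "\<dots> \<le> card (words m (0, 0) (Suc (p * k)))"
  proof (rule card_inj_on_le)
    show "inj_on ((#) (Some [])) (loops m (p * k))" by simp
    show "(#) (Some []) ` loops m (p * k) \<subseteq> words m (0, 0) (Suc (p * k))"
      using assms by (auto simp: loops_def words_def Av_0)
  qed simp
  finally show ?thesis .
qed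

lemma card_descents_power: "card (descents m p) ^ k \<le> card (words m (0, 0) (p * k))"
proof -
  let ?Z = "{w. valid m (0, 0) w \<and> None \<notin> set w \<and> fst (run (0, 0) w) = 0}"
  have L: "descents m n = {w \<in> ?Z. wt w = n}" for n by (auto simp: descents_def words_def)
  have "card (descents m p) ^ k \<le> card (descents m (p * k))"
    unfolding L
  proof (rule card_power_le)
    show "finite {w \<in> ?Z. wt w = n}" for n
      by (rule finite_subset[OF _ finite_words[of m "(0, 0)" n]]) (auto simp: words_def)
  next
    fix u w assume u: "u \<in> ?Z" and w: "w \<in> ?Z"
    obtain l where l: "run (0, 0) u = (0, l)" using u by (cases "run (0, 0) u") auto
    show "u @ w \<in> ?Z"
      using u w l valid_no_None[of w m 0 0 l] by (auto simp: valid_append)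
  qed auto
  also have "\<dots> \<le> card (words m (0, 0) (p * k))"
    by (rule card_mono) (auto simp: descents_def)
  finally show ?thesis .
qed

text \<open>From a live state one can return to \<open>(0, 1)\<close>; from \<open>(m - 1, m - 1)\<close> one cannot.\<close>

definition live :: "nat \<Rightarrow> nat \<times> nat \<Rightarrow> bool" where
  "live m s \<longleftrightarrow> fst s < m \<and> snd s < m \<and> \<not> (Suc (fst s) = m \<and> Suc (snd s) = m)"

text \<open>A live state has room in one coordinate. With room in the first,
  \<open>None, Some []\<close> returns to \<open>(0, 1)\<close>; with room in the last,
  \<open>Some [], None, Some []\<close> does. Appending a fixed word is injective.\<close>

lemma card_live_le:
  "card {w \<in> words m (0, 1) n. live m (run (0, 1) w)} \<le> card (loops m (n + 2)) + card (loops m (n + 3))"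
proof -
  let ?A = "{w \<in> words m (0, 1) n. Suc (fst (run (0, 1) w)) < m \<and> snd (run (0, 1) w) < m}"
  let ?B = "{w \<in> words m (0, 1) n. fst (run (0, 1) w) < m \<and> Suc (snd (run (0, 1) w)) < m}"
  have fin: "finite (loops m k)" for k by (simp add: loops_def)
  have "card ?A \<le> card (loops m (n + 2))"
  proof (rule card_inj_on_le)
    show "inj_on (\<lambda>w. w @ [None, Some []]) ?A" by (simp add: inj_on_def)
    show "(\<lambda>w. w @ [None, Some []]) ` ?A \<subseteq> loops m (n + 2)"
    proof (rule image_subsetI)
      fix w assume "w \<in> ?A"
      then show "w @ [None, Some []] \<in> loops m (n + 2)"
        by (cases "run (0, 1) w") (auto simp: loops_def words_def valid_append Av_0)
    qed
  qed (rule fin)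
  moreover have "card ?B \<le> card (loops m (n + 3))"
  proof (rule card_inj_on_le)
    show "inj_on (\<lambda>w. w @ [Some [], None, Some []]) ?B" by (simp add: inj_on_def)
    show "(\<lambda>w. w @ [Some [], None, Some []]) ` ?B \<subseteq> loops m (n + 3)"
    proof (rule image_subsetI)
      fix w assume "w \<in> ?B"
      then show "w @ [Some [], None, Some []] \<in> loops m (n + 3)"
        by (cases "run (0, 1) w") (auto simp: loops_def words_def valid_append Av_0)
    qed
  qed (rule fin)
  moreover have "card {w \<in> words m (0, 1) n. live m (run (0, 1) w)} \<le> card (?A \<union> ?B)"
    by (rule card_mono) (auto simp: live_def)
  ultimately show ?thesis using card_Un_le[of ?A ?B] by linarith
qed

definition tails :: "nat \<Rightarrow> nat \<Rightarrow> op list set" where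
  "tails m n = {w. wt w = n \<and> (None \<notin> set w \<and> valid m (0, 0) w \<or> set w \<subseteq> {None})}"

text \<open>After front operations the first coordinate is a deficit below \<open>m\<close>, so a
  further \<open>Some []\<close> is admissible and turns the word into a descent. The extra 1 counts
  the word of \<open>None\<close> alone.\<close>

lemma card_tails_le:
  assumes "0 < m"
  shows "finite (tails m n)" "card (tails m n) \<le> card (descents m (n + 1)) + 1"
proof -
  let ?A = "{w \<in> words m (0, 0) n. None \<notin> set w}"
  have "card ?A \<le> card (descents m (n + 1))"
  proof (rule card_inj_on_le)
    show "inj_on (\<lambda>w. w @ [Some []]) ?A" by (simp add: inj_on_def)
    show "(\<lambda>w. w @ [Some []]) ` ?A \<subseteq> descents m (n + 1)"
    proof (rule image_subsetI)
      fix w assume w: "w \<in> ?A"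
      have "fst (run (0, 0) w) < m"
      proof (cases w rule: rev_cases)
        case Nil
        then show ?thesis using assms by simp
      next
        case (snoc u x)
        then obtain L where "x = Some L" using w by (cases x) auto
        then show ?thesis using snoc w deficit_le[of L "length L"]
          by (cases "run (0, 0) u") (auto simp: words_def valid_append)
      qed
      then show "w @ [Some []] \<in> descents m (n + 1)"
        using w by (cases "run (0, 0) w") (auto simp: descents_def words_def valid_append Av_0)
    qed
    show "finite (descents m (n + 1))" by (simp add: descents_def)
  qed
  moreover have sub: "tails m n \<subseteq> insert (replicate n None) ?A"
  proof
    fix w assume w: "w \<in> tails m n"
    show "w \<in> insert (replicate n None) ?A"
    proof (cases "set w \<subseteq> {None}")
      case True
      then have "w = replicate (length w) None" by (intro replicate_eqI) auto
      then obtain k where k: "w = replicate k None" by blast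
      have "wt (replicate k None) = k" by (induction k) auto
      then show ?thesis using w k by (simp add: tails_def)
    next
      case False
      then show ?thesis using w by (simp add: tails_def words_def)
    qed
  qed
  ultimately show "finite (tails m n)" "card (tails m n) \<le> card (descents m (n + 1)) + 1"
    using card_mono[OF _ sub] card_insert_le_m1[of 1] finite_subset[OF sub] card_insert_if[of ?A "replicate n None"]
    by (auto split: if_splits)
qed

text \<open>The boundary pieces of \<open>boxed_decomposition\<close>; their number depends on
  \<open>m\<close> only.\<close>

definition short :: "nat \<Rightarrow> op list set" where
  "short m = insert [] ((\<lambda>x. [x]) ` letters m)"

lemma finite_short: "finite (short m)"
  by (simp add: short_def finite_letters)

lemma ok_short: "ok m s x \<Longrightarrow> [x] \<in> short m"
  by (auto simp: short_def dest: ok_in_letters)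

text \<open>After a first letter \<open>Some L\<close> both coordinates are at least those of
  \<open>(0, 1)\<close>, so by monotonicity the rest is valid from there. If the end is not live it
  is \<open>(m - 1, m - 1)\<close>, and deleting one letter repairs this.\<close>

lemma boxed_decomposition:
  assumes w: "valid m (0, 0) w" and r: "fst (run (0, 0) w) < m" "snd (run (0, 0) w) < m"
  shows "\<exists>h v t. w = h @ v @ t \<and> h \<in> short m \<and> t \<in> short m \<and>
    (v = [] \<or> valid m (0, 1) v \<and> live m (run (0, 1) v))"
proof (cases "w = []")
  case True
  then show ?thesis by (intro exI[of _ "[]"]) (simp add: short_def)
next
  case False
  \<comment> \<open>For \<open>m = 1\<close> every letter leaves the box, since it makes one
    coordinate positive.\<close>
  have "m \<noteq> 1"
  proof
    assume "m = 1"
    obtain u x where "w = u @ [x]" using False by (metis rev_exhaust)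
    then show False using r \<open>m = 1\<close> by (cases x; cases "run (0, 0) u") auto
  qed
  then have m: "1 < m" using r by linarith
  have "\<exists>h u. w = h @ u \<and> h \<in> short m \<and> valid m (0, 1) u \<and> fst (run (0, 1) u) < m \<and> snd (run (0, 1) u) < m"
  proof -
    obtain x u where xu: "w = x # u" using False by (cases w) auto
    show ?thesis
    proof (cases x)
      case None
      \<comment> \<open>\<open>None\<close> erases the last coordinate, so starting from
        \<open>(0, 1)\<close> instead of \<open>(0, 0)\<close> only requires
        \<open>1 < m\<close>.\<close>
      then show ?thesis using w r xu m by (intro exI[of _ "[]"] exI[of _ w]) (auto simp: short_def)
    next
      case (Some L)
      then have "valid m (deficit L, Suc (length L)) u" using w xu by simp
      then have "valid m (0, 1) u \<and> fst (run (0, 1) u) < m \<and> snd (run (0, 1) u) < m"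
        using valid_mono[of 0 "deficit L" 1 "Suc (length L)" m u] r xu Some by auto
      moreover have "[x] \<in> short m" using w xu ok_short by auto
      ultimately show ?thesis using xu by (intro exI[of _ "[x]"] exI[of _ u]) auto
    qed
  qed
  then obtain h u where u: "w = h @ u" "h \<in> short m" "valid m (0, 1) u"
    "fst (run (0, 1) u) < m" "snd (run (0, 1) u) < m" by blast
  have "\<exists>v t. u = v @ t \<and> t \<in> short m \<and> valid m (0, 1) v \<and> live m (run (0, 1) v)"
  proof (cases "live m (run (0, 1) u)")
    case True
    then show ?thesis using u by (intro exI[of _ u] exI[of _ "[]"]) (simp add: short_def)
  next
    case nl: False
    then have e: "Suc (fst (run (0, 1) u)) = m" "Suc (snd (run (0, 1) u)) = m"
      using u by (auto simp: live_def)
    have "u \<noteq> []" using e m by auto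
    then obtain v x where vx: "u = v @ [x]" by (metis rev_exhaust)
    obtain f l where fl: "run (0, 1) v = (f, l)" by fastforce
    have x: "ok m (f, l) x" "valid m (0, 1) v" using u vx fl by (auto simp: valid_append)
    \<comment> \<open>\<open>None\<close> would leave last coordinate 0, contradicting
      \<open>1 < m\<close>; \<open>Some L\<close> strictly raised the last coordinate, which was
      therefore below \<open>m - 1\<close>.\<close>
    have "live m (f, l)"
    proof (cases x)
      case None
      then show ?thesis using e vx fl m by simp
    next
      case (Some L)
      then show ?thesis using e vx fl x by (auto simp: live_def)
    qed
    then show ?thesis using vx x fl ok_short by (intro exI[of _ v] exI[of _ "[x]"]) auto
  qed
  then show ?thesis using u by blast
qed

text \<open>Only the weights of \<open>v\<close> and \<open>r\<close> index the union; those of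
  \<open>h\<close> and \<open>t\<close> are absorbed by the finite set
  \<open>short m\<close>.\<close>

lemma words_decomposition:
  assumes "0 < m"
  shows "words m (0, 0) n \<subseteq> (\<Union>i\<le>n. \<Union>j\<le>n - i. (\<lambda>(h, v, t, r). h @ v @ t @ r) `
    (short m \<times> insert [] {w \<in> words m (0, 1) i. live m (run (0, 1) w)} \<times> short m \<times> tails m j))"
proof
  fix w assume "w \<in> words m (0, 0) n"
  then have w: "valid m (0, 0) w" "wt w = n" by (auto simp: words_def)
  from valid_split[OF w(1)] assms obtain w1 r f1 l1 where
    s: "w = w1 @ r" "valid m (0, 0) w1" "run (0, 0) w1 = (f1, l1)" "f1 < m" "l1 < m"
      "None \<notin> set r \<and> valid m (0, 0) r \<or> set r \<subseteq> {None}" by blast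
  obtain h v t where hvt: "w1 = h @ v @ t" "h \<in> short m" "t \<in> short m"
    "v = [] \<or> valid m (0, 1) v \<and> live m (run (0, 1) v)"
    using boxed_decomposition[OF s(2)] s by auto
  have "v \<in> insert [] {w \<in> words m (0, 1) (wt v). live m (run (0, 1) w)}"
    using hvt(4) by (auto simp: words_def)
  moreover have "r \<in> tails m (wt r)" using s by (simp add: tails_def)
  moreover have "wt v \<le> n" "wt r \<le> n - wt v" using w s hvt by auto
  ultimately have "wt v \<in> {..n}" "wt r \<in> {..n - wt v}" "(h, v, t, r) \<in>
      short m \<times> insert [] {w \<in> words m (0, 1) (wt v). live m (run (0, 1) w)} \<times> short m \<times> tails m (wt r)"
    using hvt by auto
  moreover have "w = (\<lambda>(h, v, t, r). h @ v @ t @ r) (h, v, t, r)" using hvt s by simp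
  ultimately show "w \<in> (\<Union>i\<le>n. \<Union>j\<le>n - i. (\<lambda>(h, v, t, r). h @ v @ t @ r) `
    (short m \<times> insert [] {w \<in> words m (0, 1) i. live m (run (0, 1) w)} \<times> short m \<times> tails m j))"
    by (intro UN_I image_eqI)
qed

text \<open>Each pair \<open>(i, j)\<close> contributes a factor 3 for \<open>v\<close> (empty, or
  closed to a loop in one of two ways), 2 for the tail and the square of
  \<open>card (short m)\<close> for both ends. Closing costs at most 3 + 1 extra weight, and there
  are at most \<open>(n + 1) ^ 2\<close> pairs.\<close>

lemma card_words_le:
  fixes M :: real
  assumes "0 < m" "1 \<le> M" and loops: "\<And>p. real (card (loops m p)) \<le> M ^ p"
    and descents: "\<And>p. real (card (descents m p)) \<le> M ^ p"
  shows "real (card (words m (0, 0) n)) \<le> 6 * real (card (short m)) ^ 2 * (real n + 1) ^ 2 * M ^ (n + 4)"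
proof -
  define V where "V i = insert [] {w \<in> words m (0, 1) i. live m (run (0, 1) w)}" for i
  define H where "H = real (card (short m))"
  have finV: "finite (V i)" for i by (simp add: V_def)
  have fin: "finite (short m \<times> V i \<times> short m \<times> tails m j)" for i j
    using finite_short finV card_tails_le(1)[OF assms(1)] by blast
  have cV: "real (card (V i)) \<le> 3 * M ^ (i + 3)" for i
  proof -
    have "card (V i) \<le> Suc (card {w \<in> words m (0, 1) i. live m (run (0, 1) w)})"
      unfolding V_def by (rule card_insert_le_m1) simp_all
    also have "\<dots> \<le> Suc (card (loops m (i + 2)) + card (loops m (i + 3)))"
      using card_live_le[of m i] by simp
    finally have "real (card (V i)) \<le> 1 + real (card (loops m (i + 2))) + real (card (loops m (i + 3)))"
      by linarith
    also have "\<dots> \<le> M ^ (i + 3) + M ^ (i + 3) + M ^ (i + 3)"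
    proof (intro add_mono)
      show "1 \<le> M ^ (i + 3)" using assms(2) by simp
      have "M ^ (i + 2) \<le> M ^ (i + 3)" using assms(2) by (intro power_increasing) auto
      then show "real (card (loops m (i + 2))) \<le> M ^ (i + 3)" using loops[of "i + 2"] by linarith
    qed (rule loops)
    finally show ?thesis by simp
  qed
  have cT: "real (card (tails m j)) \<le> 2 * M ^ (j + 1)" for j
  proof -
    have "real (card (tails m j)) \<le> real (card (descents m (j + 1))) + 1"
      using card_tails_le(2)[OF assms(1), of j] by linarith
    also have "\<dots> \<le> M ^ (j + 1) + M ^ (j + 1)"
      by (intro add_mono descents one_le_power assms(2))
    finally show ?thesis by simp
  qed
  let ?B = "\<lambda>i j. (\<lambda>(h, v, t, r). h @ v @ t @ r) ` (short m \<times> V i \<times> short m \<times> tails m j)"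
  have cB: "real (card (?B i j)) \<le> 6 * H ^ 2 * M ^ (n + 4)" if "i \<le> n" "j \<le> n - i" for i j
  proof -
    have "card (?B i j) \<le> card (short m \<times> V i \<times> short m \<times> tails m j)"
      by (rule card_image_le[OF fin])
    then have "real (card (?B i j)) \<le> H ^ 2 * (real (card (V i)) * real (card (tails m j)))"
      unfolding H_def by (simp add: card_cartesian_product power2_eq_square mult_ac flip: of_nat_mult)
    also have "\<dots> \<le> H ^ 2 * ((3 * M ^ (i + 3)) * (2 * M ^ (j + 1)))"
      using assms(2) by (intro mult_left_mono mult_mono cV cT) auto
    also have "\<dots> = 6 * H ^ 2 * M ^ (i + j + 4)" by (simp add: power_add power_numeral_reduce)
    also have "\<dots> \<le> 6 * H ^ 2 * M ^ (n + 4)"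
      using assms(2) that by (intro mult_left_mono power_increasing) auto
    finally show ?thesis .
  qed
  have "card (words m (0, 0) n) \<le> card (\<Union>i\<le>n. \<Union>j\<le>n - i. ?B i j)"
    using words_decomposition[OF assms(1), of n] unfolding V_def[symmetric]
    by (rule card_mono[rotated]) (intro finite_UN_I finite_imageI fin; simp)
  also have "\<dots> \<le> (\<Sum>i\<le>n. card (\<Union>j\<le>n - i. ?B i j))" by (rule card_UN_le) simp
  also have "\<dots> \<le> (\<Sum>i\<le>n. \<Sum>j\<le>n - i. card (?B i j))" by (intro sum_mono card_UN_le) simp
  finally have "real (card (words m (0, 0) n)) \<le> (\<Sum>i\<le>n. \<Sum>j\<le>n - i. real (card (?B i j)))"
    by (simp flip: of_nat_sum)
  also have "\<dots> \<le> (\<Sum>i\<le>n. \<Sum>j\<le>n - i. 6 * H ^ 2 * M ^ (n + 4))"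
    by (intro sum_mono cB) auto
  also have "\<dots> \<le> (\<Sum>i\<le>n. (real n + 1) * (6 * H ^ 2 * M ^ (n + 4)))"
    using assms(2) by (intro sum_mono) (auto intro!: mult_right_mono)
  also have "\<dots> = 6 * H ^ 2 * (real n + 1) ^ 2 * M ^ (n + 4)"
    by (simp add: power2_eq_square algebra_simps)
  finally show ?thesis unfolding H_def .
qed

section \<open>Limits of roots\<close>

text \<open>The rate \<open>root p x\<close> is an asymptotic lower bound for \<open>root n (a n)\<close>.\<close>

definition sub_rate :: "(nat \<Rightarrow> nat) \<Rightarrow> nat \<Rightarrow> real \<Rightarrow> bool" where
  "sub_rate a p x \<longleftrightarrow> 0 \<le> x \<and> (\<exists>c. \<forall>k. x ^ k \<le> real (a (p * k + c)))"

text \<open>Otherwise the powers of \<open>x / t ^ p\<close> would outgrow the constant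
  \<open>B * t ^ c\<close>.\<close>

lemma sub_rate_le:
  assumes "sub_rate a p x" "0 < t" and bound: "\<And>n. real (a n) \<le> B * t ^ n"
  shows "x \<le> t ^ p"
proof (rule ccontr)
  assume "\<not> x \<le> t ^ p"
  then have 1: "1 < x / t ^ p" using \<open>0 < t\<close> by simp
  obtain c where c: "\<And>k. x ^ k \<le> real (a (p * k + c))" using assms(1) unfolding sub_rate_def by blast
  obtain k where "B * t ^ c < (x / t ^ p) ^ k" using real_arch_pow[OF 1] by blast
  then have "B * t ^ (p * k + c) < x ^ k"
    using \<open>0 < t\<close> unfolding power_add power_mult by (simp add: power_divide field_simps)
  then show False using c[of k] bound[of "p * k + c"] by linarith
qed

text \<open>The limit is the supremum of all rates. Monotonicity of \<open>a\<close> carries a rate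
  from the indices \<open>p * k + c\<close> to all \<open>n\<close>; conversely \<open>upper\<close>
  is applied with \<open>M\<close> equal to the supremum, and its polynomial factor vanishes under
  the root.\<close>

lemma root_limit_of_sub_rates:
  fixes a :: "nat \<Rightarrow> nat" and B t K :: real
  assumes "mono a" and pos: "\<And>n. 1 \<le> a n" and "0 < t" and bound: "\<And>n. real (a n) \<le> B * t ^ n"
    and upper: "\<And>M n. 1 \<le> M \<Longrightarrow> (\<And>p x. 1 \<le> p \<Longrightarrow> sub_rate a p x \<Longrightarrow> x \<le> M ^ p) \<Longrightarrow>
      real (a n) \<le> K * (real n + 1) ^ 2 * M ^ (n + 4)"
  obtains \<alpha> where "(\<lambda>n. root n (real (a n))) \<longlonglongrightarrow> \<alpha>"
    and "\<And>p x. 1 \<le> p \<Longrightarrow> sub_rate a p x \<Longrightarrow> root p x \<le> \<alpha>"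
proof -
  define S where "S = {root p x |p x. 1 \<le> p \<and> sub_rate a p x}"
  define \<alpha> where "\<alpha> = Sup S"
  have "s \<le> t" if s: "s \<in> S" for s
  proof -
    obtain p x where px: "1 \<le> p" "sub_rate a p x" "s = root p x" using s by (auto simp: S_def)
    have "x \<le> t ^ p" using sub_rate_le[OF px(2) \<open>0 < t\<close> bound] .
    then have "root p x \<le> root p (t ^ p)" using px by simp
    then show ?thesis using px \<open>0 < t\<close> by (simp add: real_root_power_cancel)
  qed
  then have bdd: "bdd_above S" by (rule bdd_aboveI)
  have le: "root p x \<le> \<alpha>" if "1 \<le> p" "sub_rate a p x" for p x
    unfolding \<alpha>_def by (rule cSup_upper[OF _ bdd]) (use that in \<open>auto simp: S_def\<close>)
  \<comment> \<open>The trivial rate 1 shows that the supremum is at least 1, as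
    \<open>upper\<close> requires of \<open>M\<close>.\<close>
  have "sub_rate a 1 1" using pos by (auto simp: sub_rate_def)
  then have one: "1 \<le> \<alpha>" using le[of 1 1] by simp
  have le_pow: "x \<le> \<alpha> ^ p" if "1 \<le> p" "sub_rate a p x" for p x
  proof -
    have "x = root p x ^ p" using that by (simp add: sub_rate_def)
    also have "\<dots> \<le> \<alpha> ^ p" using le[OF that] that by (intro power_mono) (auto simp: sub_rate_def)
    finally show ?thesis .
  qed
  have root_ge_1: "1 \<le> root n (real (a n))" if "1 \<le> n" for n
    using that pos[of n] by simp
  have "(\<lambda>n. root n (real (a n))) \<longlonglongrightarrow> \<alpha>"
  proof (rule order_tendstoI)
    fix y assume "y < \<alpha>"
    show "eventually (\<lambda>n. y < root n (real (a n))) sequentially"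
    proof (cases "y < 1")
      case True
      show ?thesis using eventually_ge_at_top[of 1]
      proof eventually_elim
        case (elim n)
        then show ?case using root_ge_1[of n] True by linarith
      qed
    next
      case False
      have "S \<noteq> {}" using \<open>sub_rate a 1 1\<close> by (auto simp: S_def)
      then obtain s where "s \<in> S" "y < s" using \<open>y < \<alpha>\<close> less_cSup_iff[OF _ bdd] unfolding \<alpha>_def by blast
      then obtain p x where px: "1 \<le> p" "sub_rate a p x" "s = root p x" by (auto simp: S_def)
      obtain c where c: "\<And>k. x ^ k \<le> real (a (p * k + c))" using px(2) unfolding sub_rate_def by blast
      have s1: "1 < s" using False \<open>y < s\<close> by simp
      have x: "x = s ^ p" using px by (simp add: sub_rate_def)
      have lower: "s / root n (s ^ (c + p)) \<le> root n (real (a n))" if n: "1 \<le> n" for n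
      proof (cases "n < c + p")
        case True
        have "s ^ n \<le> s ^ (c + p)" using True s1 by (intro power_increasing) auto
        then have "root n (s ^ n) \<le> root n (s ^ (c + p))" using n by simp
        then have "s \<le> root n (s ^ (c + p))" using n s1 by (simp add: real_root_power_cancel)
        then have "s / root n (s ^ (c + p)) \<le> 1" using s1 by (simp add: divide_le_eq)
        then show ?thesis using root_ge_1[OF n] by linarith
      next
        case False
        \<comment> \<open>The largest \<open>k\<close> with \<open>p * k + c \<le> n\<close>; the
          gap costs at most the factor \<open>s ^ (c + p)\<close>.\<close>
        define k where "k = (n - c) div p"
        have "p * k + c \<le> n" using times_div_less_eq_dividend[of p "n - c"] False unfolding k_def by linarith
        have "n < p * k + p + c"
          using dividend_less_times_div[of p "n - c"] px(1) False unfolding k_def by simp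
        have "s ^ n \<le> s ^ (c + p) * s ^ (p * k)"
          unfolding power_add[symmetric] using s1 \<open>n < p * k + p + c\<close> by (intro power_increasing) auto
        also have "s ^ (p * k) = x ^ k" by (simp add: x power_mult)
        also have "x ^ k \<le> real (a (p * k + c))" by (rule c)
        also have "\<dots> \<le> real (a n)" using \<open>mono a\<close> \<open>p * k + c \<le> n\<close> by (simp add: monoD)
        finally have "s ^ n \<le> s ^ (c + p) * real (a n)" using s1 by simp
        then have "root n (s ^ n) \<le> root n (s ^ (c + p) * real (a n))" using n by simp
        then have "s \<le> root n (s ^ (c + p)) * root n (real (a n))"
          using n s1 by (simp add: real_root_power_cancel real_root_mult)
        moreover have "0 < root n (s ^ (c + p))" using n s1 by simp
        ultimately show ?thesis by (simp add: divide_le_eq mult.commute)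
      qed
      have "(\<lambda>n. s / root n (s ^ (c + p))) \<longlonglongrightarrow> s / 1"
        using s1 by (intro tendsto_intros LIMSEQ_root_const) auto
      then have "eventually (\<lambda>n. y < s / root n (s ^ (c + p))) sequentially"
        using \<open>y < s\<close> by (intro order_tendstoD) auto
      then show ?thesis using eventually_ge_at_top[of 1]
        by eventually_elim (use lower in force)
    qed
  next
    fix y assume "\<alpha> < y"
    \<comment> \<open>The 4 comes from \<open>n + 1 \<le> 2 * n\<close> squared and
      \<open>\<alpha> ^ 4\<close> from the shifted exponent; \<open>+ 1\<close> makes the constant
      positive, so that its roots tend to 1.\<close>
    define K' where "K' = 4 * \<bar>K\<bar> * \<alpha> ^ 4 + 1"
    have K': "0 < K'" using one by (simp add: K'_def add_nonneg_pos)
    have up: "root n (real (a n)) \<le> root n K' * (root n (real n)) ^ 2 * \<alpha>" if n: "1 \<le> n" for n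
    proof -
      have "real (a n) \<le> K * (real n + 1) ^ 2 * \<alpha> ^ (n + 4)"
        using upper[OF one] le_pow by blast
      also have "\<dots> \<le> \<bar>K\<bar> * (2 * real n) ^ 2 * \<alpha> ^ (n + 4)"
        using one n by (intro mult_right_mono mult_mono power_mono) auto
      also have "\<dots> = 4 * \<bar>K\<bar> * \<alpha> ^ 4 * (real n ^ 2 * \<alpha> ^ n)"
        by (simp add: power_mult_distrib power_add mult_ac)
      also have "\<dots> \<le> K' * (real n ^ 2 * \<alpha> ^ n)"
        unfolding K'_def using one by (intro mult_right_mono) auto
      finally have "root n (real (a n)) \<le> root n (K' * (real n ^ 2 * \<alpha> ^ n))" using n by simp
      also have "\<dots> = root n K' * (root n (real n)) ^ 2 * \<alpha>"
        using n one by (simp add: real_root_mult real_root_power real_root_power_cancel)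
      finally show ?thesis .
    qed
    have "(\<lambda>n. root n K' * (root n (real n)) ^ 2 * \<alpha>) \<longlonglongrightarrow> 1 * 1 ^ 2 * \<alpha>"
      by (intro tendsto_intros LIMSEQ_root_const LIMSEQ_root K')
    then have "eventually (\<lambda>n. root n K' * (root n (real n)) ^ 2 * \<alpha> < y) sequentially"
      using \<open>\<alpha> < y\<close> by (intro order_tendstoD) auto
    then show "eventually (\<lambda>n. root n (real (a n)) < y) sequentially"
      using eventually_ge_at_top[of 1] by eventually_elim (use up in force)
  qed
  then show ?thesis using le that by blast
qed

section \<open>Growth constants\<close>

text \<open>Removing the first letter \<open>a\<close> leaves weight \<open>n - wt1 a\<close>; by
  induction the count is at most \<open>(1 / x) ^ n\<close> times a part of the sum, which is at
  most 1.\<close>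

lemma card_wt_letters_le:
  fixes x :: real
  assumes x: "0 < x" and sum: "(\<Sum>a\<in>letters m. x ^ wt1 a) \<le> 1"
  shows "real (card {w. set w \<subseteq> letters m \<and> wt w = n}) \<le> (1 / x) ^ n"
proof (induction n rule: less_induct)
  case (less n)
  let ?Y = "\<lambda>n. {w. set w \<subseteq> letters m \<and> wt w = n}"
  show ?case
  proof (cases "n = 0")
    case True
    then have "?Y n = {[]}" by auto
    then show ?thesis using True by simp
  next
    case False
    let ?A = "{a \<in> letters m. wt1 a \<le> n}"
    have finA: "finite ?A" using finite_letters by simp
    have "?Y n \<subseteq> (\<Union>a\<in>?A. (#) a ` ?Y (n - wt1 a))"
    proof
      fix w assume w: "w \<in> ?Y n"
      then obtain a u where "w = a # u" using False by (cases w) auto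
      then show "w \<in> (\<Union>a\<in>?A. (#) a ` ?Y (n - wt1 a))" using w by auto
    qed
    then have "card (?Y n) \<le> card (\<Union>a\<in>?A. (#) a ` ?Y (n - wt1 a))"
      using finA finite_wt_letters by (intro card_mono finite_UN_I finite_imageI) auto
    also have "\<dots> \<le> (\<Sum>a\<in>?A. card ((#) a ` ?Y (n - wt1 a)))"
      by (rule card_UN_le[OF finA])
    also have "\<dots> = (\<Sum>a\<in>?A. card (?Y (n - wt1 a)))"
      by (intro sum.cong refl card_image) simp
    finally have "real (card (?Y n)) \<le> (\<Sum>a\<in>?A. real (card (?Y (n - wt1 a))))"
      by (simp flip: of_nat_sum)
    also have "\<dots> \<le> (\<Sum>a\<in>?A. (1 / x) ^ n * x ^ wt1 a)"
    proof (rule sum_mono)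
      fix a assume a: "a \<in> ?A"
      have "real (card (?Y (n - wt1 a))) \<le> (1 / x) ^ (n - wt1 a)"
        using less.IH[of "n - wt1 a"] wt1_pos[of a] False by auto
      also have "\<dots> = (1 / x) ^ n * x ^ wt1 a"
        using x a by (simp add: power_diff power_one_over field_simps)
      finally show "real (card (?Y (n - wt1 a))) \<le> (1 / x) ^ n * x ^ wt1 a" .
    qed
    also have "\<dots> \<le> (\<Sum>a\<in>letters m. (1 / x) ^ n * x ^ wt1 a)"
      using x by (intro sum_mono2 finite_letters) auto
    also have "\<dots> = (1 / x) ^ n * (\<Sum>a\<in>letters m. x ^ wt1 a)" by (simp add: sum_distrib_left)
    also have "\<dots> \<le> (1 / x) ^ n * 1" using x sum by (intro mult_left_mono) auto
    finally show ?thesis by simp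
  qed
qed

lemma sum_letters:
  fixes x :: real
  shows "(\<Sum>a\<in>letters m. x ^ wt1 a) = x + (\<Sum>s<m. catalan s * x ^ Suc s)"
proof -
  have fin: "finite (Some ` (\<Union>s<m. Av s))" by (simp add: finite_Av)
  have "(\<Sum>a\<in>letters m. x ^ wt1 a) = x + (\<Sum>a\<in>Some ` (\<Union>s<m. Av s). x ^ wt1 a)"
    unfolding letters_def by (subst sum.insert[OF fin]) auto
  also have "(\<Sum>a\<in>Some ` (\<Union>s<m. Av s). x ^ wt1 a) = (\<Sum>L\<in>(\<Union>s<m. Av s). x ^ Suc (length L))"
    by (subst sum.reindex) auto
  also have "\<dots> = (\<Sum>s<m. \<Sum>L\<in>Av s. x ^ Suc (length L))"
    by (rule sum.UNION_disjoint) (auto simp: finite_Av dest: Av_length)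
  also have "\<dots> = (\<Sum>s<m. \<Sum>L\<in>Av s. x ^ Suc s)"
    by (intro sum.cong refl) (simp add: Av_length)
  also have "\<dots> = (\<Sum>s<m. catalan s * x ^ Suc s)" by (simp add: card_Av)
  finally show ?thesis .
qed

lemma sum_letters_quarter: "(\<Sum>a\<in>letters m. (1/4) ^ wt1 a) < (1::real)"
proof -
  have "0 \<le> real ((2 * m) choose m) / (2 * 4 ^ m)" by simp
  then show ?thesis unfolding sum_letters catalan_sum by linarith
qed

text \<open>A finite sum of powers is continuous, so the strict inequality at 1/4 persists slightly
  to its right.\<close>

lemma ex_radius: "\<exists>x>1/4. (\<Sum>a\<in>letters m. x ^ wt1 a) \<le> (1::real)"
proof -
  have "(\<lambda>n. 1/4 + inverse (real (Suc n))) \<longlonglongrightarrow> 1/4 + 0"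
    by (intro tendsto_intros LIMSEQ_inverse_real_of_nat)
  then have "(\<lambda>n. \<Sum>a\<in>letters m. (1/4 + inverse (real (Suc n))) ^ wt1 a) \<longlonglongrightarrow> (\<Sum>a\<in>letters m. (1/4 + 0) ^ wt1 a)"
    by (intro tendsto_sum tendsto_power)
  then have "eventually (\<lambda>n. (\<Sum>a\<in>letters m. (1/4 + inverse (real (Suc n))) ^ wt1 a) < 1) sequentially"
    using sum_letters_quarter[of m] by (intro order_tendstoD) auto
  then obtain n where "(\<Sum>a\<in>letters m. (1/4 + inverse (real (Suc n))) ^ wt1 a) < 1"
    using eventually_happens by force
  then show ?thesis by (intro exI[of _ "1/4 + inverse (real (Suc n))"]) simp
qed

section \<open>Exponential upper bound and monotonicity of the counts\<close>

lemma num_perms_0: "num_perms m 0 = 1"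
proof -
  have "Avb m 0 = {[]}" by (auto simp: Avb_def Av_0)
  then show ?thesis by (simp add: num_perms_eq_card_Avb)
qed

lemma num_perms_upper:
  obtains t where "0 < t" "t < 4" "\<And>n. real (num_perms m n) \<le> (1 + 1 / t) * t ^ n"
proof -
  obtain x :: real where x: "1/4 < x" "(\<Sum>a\<in>letters m. x ^ wt1 a) \<le> 1" using ex_radius by blast
  then have "0 < x" by linarith
  define t where "t = 1 / x"
  have t: "0 < t" "t < 4" using x \<open>0 < x\<close> by (auto simp: t_def field_simps)
  \<comment> \<open>The factor \<open>1 / t\<close> makes up for the starting entry, and the summand
    1 covers \<open>n = 0\<close>.\<close>
  have "real (num_perms m n) \<le> (1 + 1 / t) * t ^ n" for n
  proof (cases n)
    case 0
    then show ?thesis using t by (simp add: num_perms_0)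
  next
    case (Suc k)
    have "card (words m (0, 0) k) \<le> card {w. set w \<subseteq> letters m \<and> wt w = k}"
      by (rule card_mono[OF finite_wt_letters]) (auto simp: words_def dest: valid_subset_letters)
    also have "real \<dots> \<le> t ^ k"
      unfolding t_def by (rule card_wt_letters_le[OF \<open>0 < x\<close> x(2)])
    finally have "real (num_perms m n) \<le> t ^ k" by (simp add: Suc num_perms_Suc)
    also have "\<dots> \<le> (1 + 1 / t) * t ^ n" using t by (simp add: Suc field_simps)
    finally show ?thesis .
  qed
  then show ?thesis using that t by blast
qed

text \<open>A letter of weight 1 can always be appended. If \<open>None\<close> is forbidden, the
  last letter was a front operation, so the first coordinate is a deficit below \<open>m\<close> and
  \<open>Some []\<close> is allowed.\<close>

lemma card_words_mono:
  assumes "0 < m"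
  shows "card (words m (0, 0) n) \<le> card (words m (0, 0) (Suc n))"
proof -
  define x :: "op list \<Rightarrow> op" where "x w = (if snd (run (0, 0) w) < m then None else Some [])" for w
  have ok: "ok m (run (0, 0) w) (x w)" if w: "valid m (0, 0) w" for w
  proof (cases "snd (run (0, 0) w) < m")
    case True
    then show ?thesis by (cases "run (0, 0) w") (simp add: x_def)
  next
    case False
    have "fst (run (0, 0) w) < m"
    proof (cases w rule: rev_cases)
      case Nil
      then show ?thesis using assms by simp
    next
      case (snoc u y)
      obtain f l where fl: "run (0, 0) u = (f, l)" by fastforce
      show ?thesis
      proof (cases y)
        case None
        then show ?thesis using False snoc fl assms by simp
      next
        case (Some L)
        then show ?thesis using w snoc fl deficit_le[of L "length L"] by (auto simp: valid_append)
      qed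
    qed
    then show ?thesis using False by (cases "run (0, 0) w") (simp add: x_def Av_0)
  qed
  show ?thesis
  proof (rule card_inj_on_le)
    show "inj_on (\<lambda>w. w @ [x w]) (words m (0, 0) n)" by (simp add: inj_on_def)
    have "wt1 (x w) = 1" for w by (simp add: x_def)
    then show "(\<lambda>w. w @ [x w]) ` words m (0, 0) n \<subseteq> words m (0, 0) (Suc n)"
      using ok by (auto simp: words_def valid_append)
  qed simp
qed

lemma mono_num_perms:
  assumes "0 < m"
  shows "mono (num_perms m)"
proof (rule mono_iff_le_Suc[THEN iffD2], rule allI)
  fix n
  show "num_perms m n \<le> num_perms m (Suc n)"
  proof (cases n)
    case 0
    have "words m (0, 0) 0 = {[]}" by (auto simp: words_def)
    then show ?thesis using 0 by (simp add: num_perms_0 num_perms_Suc)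
  next
    case (Suc k)
    then show ?thesis using card_words_mono[OF assms] by (simp add: num_perms_Suc)
  qed
qed

lemma num_perms_mono_bound: "num_perms m n \<le> num_perms (Suc m) n"
  unfolding num_perms_eq_card_Avb
proof (rule card_mono)
  show "finite (Avb (Suc m) n)" using finite_Av by (simp add: Avb_def)
  show "Avb m n \<subseteq> Avb (Suc m) n" by (auto simp: Avb_def elim!: successively_mono)
qed

lemma sub_rate_loops:
  assumes "0 < m"
  shows "sub_rate (num_perms m) p (real (card (loops m p)))"
  unfolding sub_rate_def
\<comment> \<open>One for the starting entry, one for the prefix in
  \<open>card_loops_power\<close>.\<close>
proof (intro conjI exI[of _ 2] allI)
  fix k
  show "real (card (loops m p)) ^ k \<le> real (num_perms m (p * k + 2))"
    using card_loops_power[OF assms, of p k] by (simp add: num_perms_Suc flip: of_nat_power)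
qed simp

lemma sub_rate_descents: "sub_rate (num_perms m) p (real (card (descents m p)))"
  unfolding sub_rate_def
proof (intro conjI exI[of _ 1] allI)
  fix k
  show "real (card (descents m p)) ^ k \<le> real (num_perms m (p * k + 1))"
    using card_descents_power[of m p k] by (simp add: num_perms_Suc flip: of_nat_power)
qed simp

text \<open>Length \<open>m - 1\<close> is the largest allowed for a block. Its deficit is below
  \<open>m\<close>, so \<open>Some []\<close> may follow and resets the first coordinate; the
  weights are \<open>m\<close> and 1.\<close>

lemma catalan_le_card_descents:
  assumes "0 < m"
  shows "catalan (m - 1) \<le> real (card (descents m (m + 1)))"
proof -
  have "card (Av (m - 1)) \<le> card (descents m (m + 1))"
  proof (rule card_inj_on_le)
    show "inj_on (\<lambda>L. [Some L, Some []]) (Av (m - 1))" by (simp add: inj_on_def)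
    show "(\<lambda>L. [Some L, Some []]) ` Av (m - 1) \<subseteq> descents m (m + 1)"
    proof (rule image_subsetI)
      fix L assume L: "L \<in> Av (m - 1)"
      then show "[Some L, Some []] \<in> descents m (m + 1)"
        using Av_length[OF L] deficit_le[OF L] assms by (auto simp: descents_def words_def Av_0)
    qed
  qed (simp add: descents_def)
  then show ?thesis by (simp flip: card_Av)
qed

lemma growth_limit:
  assumes m: "1 \<le> m"
  shows "(\<lambda>n. root n (real (num_perms m n))) \<longlonglongrightarrow> growth_constant m"
    and "root (m + 1) (catalan (m - 1)) \<le> growth_constant m"
    and "growth_constant m < 4"
proof -
  have m0: "0 < m" using m by simp
  obtain t where t: "0 < t" "t < 4" "\<And>n. real (num_perms m n) \<le> (1 + 1 / t) * t ^ n"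
    using num_perms_upper[of m] by metis
  have pos: "1 \<le> num_perms m n" for n
    using monoD[OF mono_num_perms[OF m0], of 0 n] by (simp add: num_perms_0)
  have upper: "real (num_perms m n) \<le> 6 * real (card (short m)) ^ 2 * (real n + 1) ^ 2 * M ^ (n + 4)"
    if M: "1 \<le> M" and H: "\<And>p x. 1 \<le> p \<Longrightarrow> sub_rate (num_perms m) p x \<Longrightarrow> x \<le> M ^ p" for M n
  proof -
    \<comment> \<open>Rates are defined through \<open>p \<ge> 1\<close> in \<open>H\<close>; at
      weight 0 only the empty word remains.\<close>
    have 0: "card (loops m 0) \<le> 1" "card (descents m 0) \<le> 1"
      by (auto intro!: card_mono[of "{[]}", simplified] simp: loops_def descents_def words_def)
    have b: "real (card (words m (0, 0) k)) \<le> 6 * real (card (short m)) ^ 2 * (real k + 1) ^ 2 * M ^ (k + 4)" for k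
    proof (rule card_words_le[OF m0 M])
      fix p
      show "real (card (loops m p)) \<le> M ^ p"
        using H[OF _ sub_rate_loops[OF m0], of p] 0 by (cases p) auto
      show "real (card (descents m p)) \<le> M ^ p"
        using H[OF _ sub_rate_descents, of p] 0 by (cases p) auto
    qed
    define k where "k = n - 1"
    have "num_perms m n \<le> num_perms m (Suc k)"
      using monoD[OF mono_num_perms[OF m0], of n "Suc k"] by (simp add: k_def)
    then have "real (num_perms m n) \<le> real (card (words m (0, 0) k))" by (simp add: num_perms_Suc)
    also note b[of k]
    also have "6 * real (card (short m)) ^ 2 * (real k + 1) ^ 2 * M ^ (k + 4) \<le>
        6 * real (card (short m)) ^ 2 * (real n + 1) ^ 2 * M ^ (n + 4)"
      using M by (intro mult_mono power_mono power_increasing) (auto simp: k_def)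
    finally show ?thesis .
  qed
  obtain \<alpha> where \<alpha>: "(\<lambda>n. root n (real (num_perms m n))) \<longlonglongrightarrow> \<alpha>"
    "\<And>p x. 1 \<le> p \<Longrightarrow> sub_rate (num_perms m) p x \<Longrightarrow> root p x \<le> \<alpha>"
    using root_limit_of_sub_rates[OF mono_num_perms[OF m0] pos t(1) t(3) upper] by blast
  have gc: "growth_constant m = \<alpha>" unfolding growth_constant_def by (rule limI[OF \<alpha>(1)])
  show "(\<lambda>n. root n (real (num_perms m n))) \<longlonglongrightarrow> growth_constant m" unfolding gc by (rule \<alpha>)
  have "root (m + 1) (catalan (m - 1)) \<le> root (m + 1) (real (card (descents m (m + 1))))"
    using catalan_le_card_descents[OF m0] by simp
  also have "\<dots> \<le> \<alpha>" by (rule \<alpha>(2)[OF _ sub_rate_descents]) simp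
  finally show "root (m + 1) (catalan (m - 1)) \<le> growth_constant m" unfolding gc .
  \<comment> \<open>The bound survives the limit only weakly; strictness comes from
    \<open>t < 4\<close>.\<close>
  have "\<alpha> \<le> t"
  proof (rule LIMSEQ_le[OF \<alpha>(1)])
    have "(\<lambda>n. root n (1 + 1 / t) * t) \<longlonglongrightarrow> 1 * t"
      using t by (intro tendsto_intros LIMSEQ_root_const) (simp add: add_pos_pos)
    then show "(\<lambda>n. root n (1 + 1 / t) * t) \<longlonglongrightarrow> t" by simp
    show "\<exists>N. \<forall>n\<ge>N. root n (real (num_perms m n)) \<le> root n (1 + 1 / t) * t"
    proof (intro exI[of _ 1] allI impI)
      fix n :: nat assume n: "1 \<le> n"
      have "root n (real (num_perms m n)) \<le> root n ((1 + 1 / t) * t ^ n)" using n t(3)[of n] by simp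
      also have "\<dots> = root n (1 + 1 / t) * t"
        using n t by (simp add: real_root_mult real_root_power_cancel)
      finally show "root n (real (num_perms m n)) \<le> root n (1 + 1 / t) * t" .
    qed
  qed
  then show "growth_constant m < 4" unfolding gc using t by linarith
qed

lemma root_catalan_lower_bound:
  assumes m: "32 \<le> m"
  shows "4 - 12 * (ln (real m) / real m) \<le> root (m + 1) (catalan (m - 1))"
proof -
  \<comment> \<open>Chosen so that \<open>(4 * exp (- T)) ^ (m + 1)\<close> equals
    \<open>4 ^ (m + 1) / (32 * m ^ 2)\<close>, that is \<open>4 ^ (m - 1) / (2 * m ^ 2)\<close>, a
    lower bound for \<open>catalan (m - 1)\<close>. With \<open>m \<ge> 32\<close> the term
    \<open>ln 32\<close> is absorbed into a third \<open>ln m\<close>, and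
    \<open>exp (- T) \<ge> 1 - T\<close> yields 4 * 3 = 12.\<close>
  define T where "T = (ln 32 + 2 * ln (real m)) / (real m + 1)"
  have m0: "0 < real m" using m by simp
  have T_le: "T \<le> 3 * (ln (real m) / real m)"
  proof -
    have "ln 32 \<le> ln (real m)" using m by simp
    then have "T \<le> (3 * ln (real m)) / (real m + 1)" unfolding T_def by (intro divide_right_mono) auto
    also have "\<dots> \<le> (3 * ln (real m)) / real m" using m by (intro divide_left_mono) auto
    finally show ?thesis by simp
  qed
  have "(4 * exp (- T)) ^ (m + 1) = 4 ^ (m + 1) * exp (- (real m + 1) * T)"
    by (simp add: power_mult_distrib exp_of_nat_mult[symmetric] algebra_simps del: power_Suc power_add)
  also have "- (real m + 1) * T = - (ln 32 + 2 * ln (real m))"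
    unfolding T_def minus_mult_left[symmetric] using m0 by (subst nonzero_mult_div_cancel_left[symmetric, of "real m + 1"]) simp_all
  also have "exp (- (ln 32 + 2 * ln (real m))) = 1 / (32 * real m ^ 2)"
  proof -
    have "exp (2 * ln (real m)) = real m ^ 2" using m0 by (simp add: exp_double)
    then show ?thesis unfolding exp_minus exp_add by (simp add: inverse_eq_divide)
  qed
  also have "4 ^ (m + 1) * (1 / (32 * real m ^ 2)) = 4 ^ (m - 1) / (2 * real m ^ 2)"
  proof -
    obtain j where "m = Suc j" using m by (cases m) auto
    then show ?thesis by (simp add: field_simps)
  qed
  also have "\<dots> \<le> catalan (m - 1)"
  proof -
    have r: "real (m - 1) = real m - 1" using m by simp
    have "4 ^ (m - 1) \<le> (real m * (2 * real m - 1)) * catalan (m - 1)"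
      using catalan_lower_bound[of "m - 1"] unfolding r by (simp add: algebra_simps)
    also have "\<dots> \<le> (2 * real m ^ 2) * catalan (m - 1)"
      by (intro mult_right_mono) (auto simp: power2_eq_square algebra_simps catalan_def)
    finally show ?thesis using m0 by (simp add: divide_le_eq mult.commute)
  qed
  finally have "root (m + 1) ((4 * exp (- T)) ^ (m + 1)) \<le> root (m + 1) (catalan (m - 1))"
    by simp
  moreover have "root (m + 1) ((4 * exp (- T)) ^ (m + 1)) = 4 * exp (- T)"
    by (rule real_root_power_cancel) simp_all
  ultimately have "4 * exp (- T) \<le> root (m + 1) (catalan (m - 1))" by linarith
  moreover have "1 - T \<le> exp (- T)" using exp_ge_add_one_self[of "- T"] by simp
  ultimately show ?thesis using T_le by linarith
qed

theorem theorem4p14: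
  shows "(\<forall>m\<ge>1. convergent (\<lambda>n. root n (real (num_perms m n)))) \<and>
    (\<forall>m\<ge>1. growth_constant m \<le> growth_constant (m + 1)) \<and>
    (\<forall>m\<ge>1. root (m + 1) (catalan (m - 1)) \<le> growth_constant m \<and> growth_constant m < 4) \<and>
    growth_constant \<longlonglongrightarrow> 4 \<and>
    (\<lambda>m. 4 - growth_constant m) \<in> O(\<lambda>m. ln (real m) / real m)"
proof (intro conjI allI impI)
  fix m :: nat assume m: "1 \<le> m"
  show "convergent (\<lambda>n. root n (real (num_perms m n)))"
    using growth_limit(1)[OF m] by (auto simp: convergent_def)
  show "growth_constant m \<le> growth_constant (m + 1)"
  proof (rule LIMSEQ_le[OF growth_limit(1)[OF m] growth_limit(1)])
    show "\<exists>N. \<forall>n\<ge>N. root n (real (num_perms m n)) \<le> root n (real (num_perms (m + 1) n))"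
      using num_perms_mono_bound[of m] by (intro exI[of _ 1]) auto
  qed simp
  show "root (m + 1) (catalan (m - 1)) \<le> growth_constant m" "growth_constant m < 4"
    using growth_limit[OF m] by auto
next
  have lower: "4 - 12 * (ln (real m) / real m) \<le> growth_constant m" if "32 \<le> m" for m
    using root_catalan_lower_bound[OF that] growth_limit(2)[of m] that by linarith
  have lim: "(\<lambda>m. 4 - 12 * (ln (real m) / real m)) \<longlonglongrightarrow> 4 - 12 * 0"
    by (intro tendsto_intros lim_ln_over_n)
  show "growth_constant \<longlonglongrightarrow> 4"
  proof (rule tendsto_sandwich)
    show "eventually (\<lambda>m. 4 - 12 * (ln (real m) / real m) \<le> growth_constant m) sequentially"
      using eventually_ge_at_top[of 32] by eventually_elim (rule lower)
    show "eventually (\<lambda>m. growth_constant m \<le> 4) sequentially"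
      using eventually_ge_at_top[of 1] by eventually_elim (use growth_limit(3) in force)
    show "(\<lambda>m. 4 - 12 * (ln (real m) / real m)) \<longlonglongrightarrow> 4" using lim by simp
  qed simp
  show "(\<lambda>m. 4 - growth_constant m) \<in> O(\<lambda>m. ln (real m) / real m)"
  proof (rule bigoI[of _ 12])
    show "eventually (\<lambda>m. norm (4 - growth_constant m) \<le> 12 * norm (ln (real m) / real m)) sequentially"
      using eventually_ge_at_top[of 32]
    proof eventually_elim
      case (elim m)
      then have "norm (4 - growth_constant m) = 4 - growth_constant m" using growth_limit(3)[of m] by simp
      moreover have "norm (ln (real m) / real m) = ln (real m) / real m" using elim by simp
      ultimately show ?case using lower[OF elim] by linarith
    qed
  qed
qed

end
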